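(* Let $d\ge 3$ and $S=\mathbb{C}[m_0,\ldots,m_d]$. The $3\times 3$ minors of the matrix $$H_d^{\mathrm{IG}}=\begin{pmatrix} m_0^2 & m_0 & m_1 & m_2 & m_3&\cdots& m_{d-2}\\ 0 & m_1 & 3m_2 & 5m_3 & 7m_4 &\cdots& (2d-3)m_{d-1}\\ m_1^2 & m_2 & m_3 &m_4 &m_5& \cdots& m_d \end{pmatrix}$$ form a Gröbner basis for the homogeneous vanishing ideal $\mathcal{I}(\mathcal{M}^{\mathrm{IG}}_d)\subseteq S$ of the $d$th inverse Gaussian moment variety with respect to any antidiagonal term order (for example, the reverse lexicographic ordering). Furthermore, the Hilbert series of $S/\mathcal{I}(\mathcal{M}^{\mathrm{IG}}_d)$ is given by $$\frac{1+(d-2)t+\binom{d-1}{2}t^2+\binom{d-1}{2}t^3}{(1-t)^3}.$$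
   Context: The moments of the inverse Gaussian distribution with parameters $\mu,\lambda$ are given by $m_0=1$, $m_1=\mu$, and $m_i=\frac{2i-3}{\lambda}\mu^2 m_{i-1}+\mu^2 m_{i-2}$ for $i\geq 2$. The inverse Gaussian moment variety $\mathcal{M}^{\mathrm{IG}}_d\subseteq\mathbb{P}^d$ is the Zariski closure of the set of points $[m_0(\mu,\lambda):m_1(\mu,\lambda):\cdots:m_d(\mu,\lambda)]$ with $\mu\in\mathbb{C}$, $\lambda\in\mathbb{C}\setminus\{0\}$. In $H_d^{\mathrm{IG}}$, the first column is $(m_0^2,0,m_1^2)^\top$ and for $2\le i\le d$ the $i$th column is $(m_{i-2},(2i-3)m_{i-1},m_i)^\top$. An antidiagonal term order is a monomial order on $S$ for which the initial monomial of each $3\times 3$ minor of the matrix is (up to a scalar) the product of the entries on its antidiagonal, i.e. for columns $i<j<k$, the product of the entries in positions $(3,i),(2,j),(1,k)$. The reverse lexicographic ordering is the graded one with $m_0>m_1>\cdots>m_d$. The polynomial ring $S$ has the standard grading. *)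

theory Defs
  imports
    Complex_Main
    "HOL-Library.Poly_Mapping"
    "HOL-Computational_Algebra.Formal_Power_Series"
    "HOL-Algebra.QuotRing"
    "HOL-Algebra.Embedded_Algebras"
    "Jordan_Normal_Form.Determinant"
begin

section \<open>The graded polynomial ring in the variables with indices 0 to d\<close>

text \<open>
  Polynomials in countably many variables are finitely supported maps from monomials (exponent
  vectors) to coefficients, with the convolution product of the library. The ring in the
  variables with indices \<open>0, \<dots>, d\<close> is a carrier inside this type.
\<close>

type_synonym mon = "nat \<Rightarrow>\<^sub>0 nat"
type_synonym cpoly = "mon \<Rightarrow>\<^sub>0 complex"

definition mons :: "nat \<Rightarrow> mon set" where
  "mons d = {a. Poly_Mapping.keys a \<subseteq> {..d}}"

definition poly_ring :: "nat \<Rightarrow> cpoly ring" where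
  "poly_ring d =
     \<lparr>carrier = {p. Poly_Mapping.keys p \<subseteq> mons d}, mult = (*), one = 1, zero = 0, add = (+)\<rparr>"

definition Xvar :: "nat \<Rightarrow> cpoly" where
  "Xvar i = Poly_Mapping.single (Poly_Mapping.single i 1) 1"

definition mon_poly :: "mon \<Rightarrow> cpoly" where
  "mon_poly a = Poly_Mapping.single a 1"

definition mon_deg :: "mon \<Rightarrow> nat" where
  "mon_deg a = (\<Sum>i\<in>Poly_Mapping.keys a. Poly_Mapping.lookup a i)"

text \<open>The zero polynomial is homogeneous of every degree.\<close>

definition homogeneous :: "nat \<Rightarrow> cpoly \<Rightarrow> bool" where
  "homogeneous n p \<longleftrightarrow> (\<forall>a\<in>Poly_Mapping.keys p. mon_deg a = n)"

definition homogeneous_polys :: "nat \<Rightarrow> cpoly set" where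
  "homogeneous_polys d = {p \<in> carrier (poly_ring d). \<exists>n. homogeneous n p}"

definition eval_poly :: "(nat \<Rightarrow> complex) \<Rightarrow> cpoly \<Rightarrow> complex" where
  "eval_poly x p =
     (\<Sum>a\<in>Poly_Mapping.keys p. Poly_Mapping.lookup p a *
        (\<Prod>i\<in>Poly_Mapping.keys a. x i ^ Poly_Mapping.lookup a i))"


section \<open>Projective space, Zariski closure, vanishing ideals\<close>

text \<open>
  A point of projective d-space is the set of all its homogeneous coordinate vectors. Coordinate
  vectors are extended by zero beyond the index \<open>d\<close>.
\<close>

definition proj_point :: "nat \<Rightarrow> (nat \<Rightarrow> complex) \<Rightarrow> (nat \<Rightarrow> complex) set" where
  "proj_point d x = {(\<lambda>i. if i \<le> d then c * x i else 0) | c. c \<noteq> 0}"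

definition proj_space :: "nat \<Rightarrow> (nat \<Rightarrow> complex) set set" where
  "proj_space d = {proj_point d x | x. \<exists>i\<le>d. x i \<noteq> 0}"

definition vanishes_at :: "cpoly \<Rightarrow> (nat \<Rightarrow> complex) set \<Rightarrow> bool" where
  "vanishes_at f P \<longleftrightarrow> (\<forall>x\<in>P. eval_poly x f = 0)"

definition proj_zero_set :: "nat \<Rightarrow> cpoly set \<Rightarrow> (nat \<Rightarrow> complex) set set" where
  "proj_zero_set d F = {P \<in> proj_space d. \<forall>f\<in>F. vanishes_at f P}"

definition zariski_closure :: "nat \<Rightarrow> (nat \<Rightarrow> complex) set set \<Rightarrow> (nat \<Rightarrow> complex) set set" where
  "zariski_closure d X =
     \<Inter>{proj_zero_set d F | F. F \<subseteq> homogeneous_polys d \<and> X \<subseteq> proj_zero_set d F}"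

definition vanishing_ideal :: "nat \<Rightarrow> (nat \<Rightarrow> complex) set set \<Rightarrow> cpoly set" where
  "vanishing_ideal d X =
     Idl\<^bsub>poly_ring d\<^esub> {f \<in> homogeneous_polys d. \<forall>P\<in>X. vanishes_at f P}"


section \<open>The inverse Gaussian moment variety\<close>

fun ig_moment :: "complex \<Rightarrow> complex \<Rightarrow> nat \<Rightarrow> complex" where
  "ig_moment \<mu> l 0 = 1"
| "ig_moment \<mu> l (Suc 0) = \<mu>"
| "ig_moment \<mu> l (Suc (Suc n)) =
     of_nat (2 * (n + 2) - 3) / l * \<mu>\<^sup>2 * ig_moment \<mu> l (Suc n) + \<mu>\<^sup>2 * ig_moment \<mu> l n"

definition ig_variety :: "nat \<Rightarrow> (nat \<Rightarrow> complex) set set" where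
  "ig_variety d = zariski_closure d {proj_point d (ig_moment \<mu> l) | \<mu> l. l \<noteq> 0}"

text \<open>
  Rows and columns are numbered from 0, so column \<open>c \<ge> 1\<close> is the column with
  number \<open>c + 1\<close> in the usual numbering from 1, and \<open>2 * c - 1 = 2 * (c + 1) - 3\<close>.
\<close>

definition ig_matrix :: "nat \<Rightarrow> cpoly mat" where
  "ig_matrix d = mat 3 d (\<lambda>(r, c).
     if c = 0 then [(Xvar 0)\<^sup>2, 0, (Xvar 1)\<^sup>2] ! r
     else [Xvar (c - 1), of_nat (2 * c - 1) * Xvar c, Xvar (c + 1)] ! r)"

definition ig_minor :: "nat \<Rightarrow> nat \<Rightarrow> nat \<Rightarrow> nat \<Rightarrow> cpoly" where
  "ig_minor d i j k =
     det (mat_of_cols 3 [col (ig_matrix d) i, col (ig_matrix d) j, col (ig_matrix d) k])"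

definition ig_minors :: "nat \<Rightarrow> cpoly set" where
  "ig_minors d = {ig_minor d i j k | i j k. i < j \<and> j < k \<and> k < d}"


section \<open>Monomial orders and Groebner bases\<close>

text \<open>
  A monomial order is given by its reflexive relation, which is only constrained on the monomials
  in the variables with indices \<open>0, \<dots>, d\<close>.
\<close>

definition monomial_order :: "nat \<Rightarrow> (mon \<Rightarrow> mon \<Rightarrow> bool) \<Rightarrow> bool" where
  "monomial_order d leq \<longleftrightarrow>
     (\<forall>a\<in>mons d. \<forall>b\<in>mons d. leq a b \<or> leq b a) \<and>
     (\<forall>a\<in>mons d. \<forall>b\<in>mons d. leq a b \<and> leq b a \<longrightarrow> a = b) \<and>
     (\<forall>a\<in>mons d. \<forall>b\<in>mons d. \<forall>c\<in>mons d. leq a b \<and> leq b c \<longrightarrow> leq a c) \<and>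
     (\<forall>a\<in>mons d. leq 0 a) \<and>
     (\<forall>a\<in>mons d. \<forall>b\<in>mons d. \<forall>c\<in>mons d. leq a b \<longrightarrow> leq (a + c) (b + c))"

text \<open>A relation, since the zero polynomial has no initial monomial.\<close>

definition is_initial_mon :: "(mon \<Rightarrow> mon \<Rightarrow> bool) \<Rightarrow> cpoly \<Rightarrow> mon \<Rightarrow> bool" where
  "is_initial_mon leq p a \<longleftrightarrow>
     a \<in> Poly_Mapping.keys p \<and> (\<forall>b\<in>Poly_Mapping.keys p. leq b a)"

definition initial_ideal :: "nat \<Rightarrow> (mon \<Rightarrow> mon \<Rightarrow> bool) \<Rightarrow> cpoly set \<Rightarrow> cpoly set" where
  "initial_ideal d leq F = Idl\<^bsub>poly_ring d\<^esub> {mon_poly a | a. \<exists>f\<in>F. is_initial_mon leq f a}"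

definition groebner_basis ::
    "nat \<Rightarrow> (mon \<Rightarrow> mon \<Rightarrow> bool) \<Rightarrow> cpoly set \<Rightarrow> cpoly set \<Rightarrow> bool" where
  "groebner_basis d leq G I \<longleftrightarrow>
     ideal I (poly_ring d) \<and> finite G \<and> G \<subseteq> I \<and> initial_ideal d leq G = initial_ideal d leq I"

definition antidiagonal_order :: "nat \<Rightarrow> (mon \<Rightarrow> mon \<Rightarrow> bool) \<Rightarrow> bool" where
  "antidiagonal_order d leq \<longleftrightarrow> monomial_order d leq \<and>
     (\<forall>i j k. i < j \<and> j < k \<and> k < d \<longrightarrow>
        (\<exists>a s. is_initial_mon leq (ig_minor d i j k) a \<and> s \<noteq> 0 \<and>
           ig_matrix d $$ (2, i) * ig_matrix d $$ (1, j) * ig_matrix d $$ (0, k) =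
             Poly_Mapping.single a s))"

text \<open>Graded reverse lexicographic order in which the variable with index 0 is the largest.\<close>

definition revlex :: "mon \<Rightarrow> mon \<Rightarrow> bool" where
  "revlex a b \<longleftrightarrow> a = b \<or> mon_deg a < mon_deg b \<or>
     (mon_deg a = mon_deg b \<and>
      (\<exists>i. Poly_Mapping.lookup a i > Poly_Mapping.lookup b i \<and>
           (\<forall>j>i. Poly_Mapping.lookup a j = Poly_Mapping.lookup b j)))"


section \<open>Hilbert series\<close>

text \<open>
  For a homogeneous ideal, the degree-\<open>n\<close> piece of the quotient ring is the image of the
  homogeneous polynomials of degree \<open>n\<close>. Its dimension is taken over the image of the
  constant polynomials.
\<close>

definition quot_image :: "nat \<Rightarrow> cpoly set \<Rightarrow> cpoly set \<Rightarrow> cpoly set set" where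
  "quot_image d I A = (\<lambda>p. I +>\<^bsub>poly_ring d\<^esub> p) ` A"

definition hilbert_function :: "nat \<Rightarrow> cpoly set \<Rightarrow> nat \<Rightarrow> nat" where
  "hilbert_function d I n =
     ring.dim (poly_ring d Quot I)
       (quot_image d I {Poly_Mapping.single 0 c | c. True})
       (quot_image d I {p \<in> carrier (poly_ring d). homogeneous n p})"

definition hilbert_series :: "nat \<Rightarrow> cpoly set \<Rightarrow> rat fps" where
  "hilbert_series d I = Abs_fps (\<lambda>n. of_nat (hilbert_function d I n))"

end

theory Submission
  imports Defs
begin

text \<open>
  On the curve \<open>\<mu>\<^sup>2 / \<lambda> = 1\<close> the moments are univariate polynomials \<open>p\<^sub>i\<close> with \<open>p\<^sub>0 = 1\<close> and with
  \<open>p\<^sub>i\<close> of order 1 at the origin for \<open>i \<ge> 1\<close>. A form that is homogeneous for the standard grading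
  and for the grading in which \<open>m\<^sub>i\<close> has weight \<open>i\<close> lies in the ideal iff it vanishes on this curve.
  The minors vanish there, so every monomial restricts to a linear combination of restrictions
  of standard monomials, those that no antidiagonal term divides.
  A monomial of degree \<open>b\<close> in the variables other than \<open>m\<^sub>0\<close> restricts to a polynomial of order \<open>b\<close>,
  so in weight \<open>w\<close> (and in large degree) the restrictions span at least as many dimensions as there
  are \<open>b\<close> with \<open>b \<le> w \<le> d b\<close>. Counting shows that there are no more standard monomials than that,
  hence their restrictions are linearly independent. So the standard monomials form a basis modulo
  the vanishing ideal.
\<close>

section \<open>Bidegrees and evaluation\<close>

text \<open>The weight grading reflects the scaling law of the distribution: multiplying
  \<open>\<mu>\<close> and \<open>\<lambda>\<close> by the same \<open>s\<close> multiplies the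
  moment of index \<open>i\<close> by \<open>s^i\<close>. Together with the projective scaling this
  gives a two-dimensional torus, and one curve meeting its orbits suffices. The minors vanish there
  because the moment recurrence makes the last row of the matrix the middle row plus
  \<open>x^2\<close> times the top row. The two counts agree because antidiagonal terms only involve
  the variables \<open>1, ..., d - 2\<close>. In a standard monomial the variables \<open>0\<close>,
  \<open>d - 1\<close>, \<open>d\<close> are therefore free; degree fixes the exponent of the first,
  and division with remainder by \<open>d\<close> and \<open>d - 1\<close> encodes the rest of a
  given weight by a single number. The orders \<open>b \<le> w\<close> are realized in degree
  \<open>n\<close> by padding with powers of the variable 0, which requires
  \<open>n \<ge> w\<close>. Smaller degrees are reached because multiplying by that variable keeps
  monomials standard and does not change their restrictions. Rewriting into standard monomials also
  records that they are not larger than the monomial rewritten. This turns independence into the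
  Groebner property for every antidiagonal order at once, without S-pairs.\<close>

lemma sum_keys_add:
  fixes a b :: mon and g :: "nat \<Rightarrow> nat"
  shows "(\<Sum>i\<in>Poly_Mapping.keys (a + b). g i * Poly_Mapping.lookup (a + b) i) =
    (\<Sum>i\<in>Poly_Mapping.keys a. g i * Poly_Mapping.lookup a i) +
    (\<Sum>i\<in>Poly_Mapping.keys b. g i * Poly_Mapping.lookup b i)"
  by (rule setsum_keys_plus_distrib) (simp_all add: distrib_left)

definition mon_weight :: "mon \<Rightarrow> nat" where
  "mon_weight a = (\<Sum>i\<in>Poly_Mapping.keys a. i * Poly_Mapping.lookup a i)"

lemma mon_deg_add [simp]: "mon_deg (a + b) = mon_deg a + mon_deg b"
  using sum_keys_add[of "\<lambda>_. 1"] by (simp add: mon_deg_def)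

lemma mon_weight_add [simp]: "mon_weight (a + b) = mon_weight a + mon_weight b"
  using sum_keys_add[of "\<lambda>i. i"] by (simp add: mon_weight_def)

lemma mon_deg_single [simp]: "mon_deg (Poly_Mapping.single i k) = k"
  by (simp add: mon_deg_def)

lemma mon_weight_single [simp]: "mon_weight (Poly_Mapping.single i k) = i * k"
  by (simp add: mon_weight_def)

lemma mon_deg_0 [simp]: "mon_deg 0 = 0" and mon_weight_0 [simp]: "mon_weight 0 = 0"
  by (simp_all add: mon_deg_def mon_weight_def)

lemma keys_add_mon: "Poly_Mapping.keys (a + b :: mon) = Poly_Mapping.keys a \<union> Poly_Mapping.keys b"
  by (auto simp: in_keys_iff lookup_add)

lemma mons_add [simp]: "a + b \<in> mons d \<longleftrightarrow> a \<in> mons d \<and> b \<in> mons d"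
  by (auto simp: mons_def keys_add_mon)

lemma mons_single [simp]: "Poly_Mapping.single i k \<in> mons d \<longleftrightarrow> i \<le> d \<or> k = 0"
  by (auto simp: mons_def)

lemma mons_0 [simp]: "0 \<in> mons d"
  by (simp add: mons_def)

section \<open>Evaluation of monomials and polynomials\<close>

definition mon_eval :: "(nat \<Rightarrow> 'a::comm_monoid_mult) \<Rightarrow> mon \<Rightarrow> 'a" where
  "mon_eval x a = (\<Prod>i\<in>Poly_Mapping.keys a. x i ^ Poly_Mapping.lookup a i)"

lemma mon_eval_superset:
  assumes "finite A" "Poly_Mapping.keys a \<subseteq> A"
  shows "mon_eval x a = (\<Prod>i\<in>A. x i ^ Poly_Mapping.lookup a i)"
  unfolding mon_eval_def using assms
  by (intro prod.mono_neutral_left) (auto simp: in_keys_iff)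

lemma mon_eval_add [simp]: "mon_eval x (a + b) = mon_eval x a * mon_eval x b"
proof -
  let ?A = "Poly_Mapping.keys a \<union> Poly_Mapping.keys b"
  show ?thesis
    by (simp add: mon_eval_superset[of ?A] keys_add_mon lookup_add power_add prod.distrib)
qed

lemma mon_eval_single [simp]: "mon_eval x (Poly_Mapping.single i k) = x i ^ k"
  by (simp add: mon_eval_def)

lemma mon_eval_0 [simp]: "mon_eval x 0 = 1"
  by (simp add: mon_eval_def)

text \<open>The torus with parameters \<open>c\<close> and \<open>s\<close> acts on each monomial by
  a character that records its degree and weight. Comparing powers of \<open>c\<close> and
  \<open>s\<close> later separates the bidegrees.\<close>

lemma mon_eval_scale:
  fixes x :: "nat \<Rightarrow> 'a::comm_semiring_1"
  shows "mon_eval (\<lambda>i. c * s ^ i * x i) a = c ^ mon_deg a * s ^ mon_weight a * mon_eval x a"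
  by (simp add: mon_eval_def mon_deg_def mon_weight_def power_mult_distrib prod.distrib
      power_sum power_mult)

lemma mon_eval_cong:
  assumes "a \<in> mons d" "\<And>i. i \<le> d \<Longrightarrow> x i = y i"
  shows "mon_eval x a = mon_eval y a"
  using assms by (auto simp: mon_eval_def mons_def intro!: prod.cong)

lemma poly_mon_eval: "poly (mon_eval p a) x = mon_eval (\<lambda>i. poly (p i) x) a"
  by (simp add: mon_eval_def poly_prod)

lemma eval_poly_alt:
  "eval_poly x p = (\<Sum>a\<in>Poly_Mapping.keys p. Poly_Mapping.lookup p a * mon_eval x a)"
  by (simp add: eval_poly_def mon_eval_def)

lemma eval_poly_add [simp]: "eval_poly x (p + q) = eval_poly x p + eval_poly x q"
  unfolding eval_poly_alt by (rule setsum_keys_plus_distrib) (simp_all add: distrib_right)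

lemma eval_poly_0 [simp]: "eval_poly x 0 = 0"
  by (simp add: eval_poly_alt)

lemma eval_poly_single [simp]: "eval_poly x (Poly_Mapping.single a c) = c * mon_eval x a"
  by (simp add: eval_poly_alt)

lemma eval_poly_uminus [simp]: "eval_poly x (- p) = - eval_poly x p"
  by (simp add: eval_poly_alt sum_negf)

lemma eval_poly_diff [simp]: "eval_poly x (p - q) = eval_poly x p - eval_poly x q"
  using eval_poly_add[of x p "- q"] by simp

lemma eval_poly_sum: "eval_poly x (\<Sum>i\<in>A. f i) = (\<Sum>i\<in>A. eval_poly x (f i))"
  by (induction A rule: infinite_finite_induct) auto

lemma cpoly_sum_single:
  fixes p :: cpoly
  shows "p = (\<Sum>a\<in>Poly_Mapping.keys p. Poly_Mapping.single a (Poly_Mapping.lookup p a))"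
  by (rule poly_mapping_eqI)
    (simp add: lookup_sum lookup_single when_def sum.delta' not_in_keys_iff_lookup_eq_zero)

lemma eval_poly_mult [simp]: "eval_poly x (p * q) = eval_poly x p * eval_poly x q"
proof -
  have "p * q = (\<Sum>a\<in>Poly_Mapping.keys p. \<Sum>b\<in>Poly_Mapping.keys q.
      Poly_Mapping.single (a + b) (Poly_Mapping.lookup p a * Poly_Mapping.lookup q b))"
    by (rule trans[OF arg_cong2[of _ _ _ _ "(*)", OF cpoly_sum_single cpoly_sum_single]])
      (simp add: sum_product mult_single)
  then have "eval_poly x (p * q) = (\<Sum>a\<in>Poly_Mapping.keys p. \<Sum>b\<in>Poly_Mapping.keys q.
      (Poly_Mapping.lookup p a * mon_eval x a) * (Poly_Mapping.lookup q b * mon_eval x b))"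
    by (simp add: eval_poly_sum mult.assoc mult.left_commute)
  then show ?thesis
    by (simp add: eval_poly_alt sum_product)
qed

lemma eval_poly_1 [simp]: "eval_poly x 1 = 1"
  using eval_poly_single[of x 0 1] by simp

lemma eval_poly_cong:
  assumes "Poly_Mapping.keys p \<subseteq> mons d" "\<And>i. i \<le> d \<Longrightarrow> x i = y i"
  shows "eval_poly x p = eval_poly y p"
  using assms mon_eval_cong[of _ d x y] by (auto simp: eval_poly_alt intro!: sum.cong)

section \<open>The polynomial ring as a commutative ring\<close>

lemma carrier_poly_ring [simp]: "p \<in> carrier (poly_ring d) \<longleftrightarrow> Poly_Mapping.keys p \<subseteq> mons d"
  by (simp add: poly_ring_def)

lemma poly_ring_ops [simp]:
  "mult (poly_ring d) = (*)" "one (poly_ring d) = 1" "zero (poly_ring d) = 0"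
  "add (poly_ring d) = (+)"
  by (simp_all add: poly_ring_def)

lemma keys_mult_mons:
  assumes "Poly_Mapping.keys (p :: cpoly) \<subseteq> mons d" "Poly_Mapping.keys q \<subseteq> mons d"
  shows "Poly_Mapping.keys (p * q) \<subseteq> mons d"
proof
  fix c assume "c \<in> Poly_Mapping.keys (p * q)"
  then obtain a b where "c = a + b" "a \<in> Poly_Mapping.keys p" "b \<in> Poly_Mapping.keys q"
    using keys_mult[of p q] by auto
  then show "c \<in> mons d" using assms by auto
qed

lemma keys_add_mons:
  assumes "Poly_Mapping.keys (p :: cpoly) \<subseteq> mons d" "Poly_Mapping.keys q \<subseteq> mons d"
  shows "Poly_Mapping.keys (p + q) \<subseteq> mons d"
  using assms keys_add[of p q] by blast

lemma poly_ring_cring: "cring (poly_ring d)"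
proof (rule cringI)
  show "abelian_group (poly_ring d)"
  proof (rule abelian_groupI, goal_cases)
    \<comment> \<open>The sixth axiom asks for an additive inverse.\<close>
    case (6 x)
    then show ?case by (intro bexI[of _ "- x"]) auto
  qed (auto simp: keys_add_mons add.assoc add.commute intro: subsetD[OF keys_add_mons])
  show "Group.comm_monoid (poly_ring d)"
    by (rule comm_monoidI)
      (auto simp: mult.assoc mult.commute intro: subsetD[OF keys_mult_mons])
qed (simp add: distrib_right)

section \<open>The minors and their antidiagonal terms\<close>

lemma det_2:
  fixes A :: "'a::comm_ring_1 mat"
  assumes "A \<in> carrier_mat 2 2"
  shows "det A = A $$ (0,0) * A $$ (1,1) - A $$ (0,1) * A $$ (1,0)"
proof -
  have "det A = (\<Sum>j<2. A $$ (0,j) * cofactor A 0 j)"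
    by (rule laplace_expansion_row[OF assms]) simp
  then show ?thesis
    using assms by (simp add: eval_nat_numeral cofactor_def mat_delete_def det_single)
qed

lemma det_3:
  fixes A :: "'a::comm_ring_1 mat"
  assumes "A \<in> carrier_mat 3 3"
  shows "det A = A $$ (0,0) * (A $$ (1,1) * A $$ (2,2) - A $$ (1,2) * A $$ (2,1))
    - A $$ (0,1) * (A $$ (1,0) * A $$ (2,2) - A $$ (1,2) * A $$ (2,0))
    + A $$ (0,2) * (A $$ (1,0) * A $$ (2,1) - A $$ (1,1) * A $$ (2,0))"
proof -
  have "det A = (\<Sum>j<3. A $$ (0,j) * cofactor A 0 j)"
    by (rule laplace_expansion_row[OF assms]) simp
  also have "{..<3::nat} = {0,1,2}" by auto
  finally show ?thesis
    using assms by (simp add: cofactor_def mat_delete_def det_2 algebra_simps numeral_2_eq_2)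
qed

lemma det_mat_of_cols_3:
  fixes u v w :: "'a::comm_ring_1 vec"
  assumes "u \<in> carrier_vec 3" "v \<in> carrier_vec 3" "w \<in> carrier_vec 3"
  shows "det (mat_of_cols 3 [u, v, w]) = u $ 0 * (v $ 1 * w $ 2 - w $ 1 * v $ 2)
    - v $ 0 * (u $ 1 * w $ 2 - w $ 1 * u $ 2) + w $ 0 * (u $ 1 * v $ 2 - v $ 1 * u $ 2)"
  by (subst det_3) (auto simp: mat_of_cols_index intro!: carrier_matI)

abbreviation var_mon :: "nat \<Rightarrow> mon" where
  "var_mon i \<equiv> Poly_Mapping.single i 1"

text \<open>The bottom entry of column 0 is a square, so the terms with \<open>i = 0\<close> have
  degree 4 and all others have degree 3. The index \<open>k - 1\<close> is that of the top entry of
  column \<open>k\<close>, where \<open>k \<ge> 2\<close> in every minor.\<close>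

definition antidiag_mon :: "nat \<Rightarrow> nat \<Rightarrow> nat \<Rightarrow> mon" where
  "antidiag_mon i j k =
     (if i = 0 then var_mon 1 + var_mon 1 else var_mon (Suc i)) + var_mon j + var_mon (k - 1)"

lemma ig_matrix_dims [simp]: "dim_row (ig_matrix d) = 3" "dim_col (ig_matrix d) = d"
  by (simp_all add: ig_matrix_def)

lemma ig_minor_expand:
  assumes "i < j" "j < k" "k < d"
  shows "ig_minor d i j k =
    ig_matrix d $$ (0,i) * (ig_matrix d $$ (1,j) * ig_matrix d $$ (2,k)
      - ig_matrix d $$ (1,k) * ig_matrix d $$ (2,j))
    - ig_matrix d $$ (0,j) * (ig_matrix d $$ (1,i) * ig_matrix d $$ (2,k)
      - ig_matrix d $$ (1,k) * ig_matrix d $$ (2,i))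
    + ig_matrix d $$ (0,k) * (ig_matrix d $$ (1,i) * ig_matrix d $$ (2,j)
      - ig_matrix d $$ (1,j) * ig_matrix d $$ (2,i))"
  using assms unfolding ig_minor_def
  by (subst det_mat_of_cols_3) (auto intro!: carrier_vecI)

lemma ig_matrix_0:
  assumes "0 < d"
  shows "ig_matrix d $$ (0,0) = Poly_Mapping.single (var_mon 0 + var_mon 0) 1"
    "ig_matrix d $$ (1,0) = 0"
    "ig_matrix d $$ (2,0) = Poly_Mapping.single (var_mon 1 + var_mon 1) 1"
  using assms by (simp_all add: ig_matrix_def Xvar_def power2_eq_square mult_single)

lemma ig_matrix_Suc:
  assumes "Suc c < d"
  shows "ig_matrix d $$ (0, Suc c) = Poly_Mapping.single (var_mon c) 1"
    "ig_matrix d $$ (1, Suc c) = Poly_Mapping.single (var_mon (Suc c)) (of_nat (Suc (2 * c)))"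
    "ig_matrix d $$ (2, Suc c) = Poly_Mapping.single (var_mon (Suc (Suc c))) 1"
proof -
  show "ig_matrix d $$ (1, Suc c) = Poly_Mapping.single (var_mon (Suc c)) (of_nat (Suc (2 * c)))"
    using assms unfolding ig_matrix_def
    by (simp add: Xvar_def mult_single flip: single_of_nat del: of_nat_Suc of_nat_add of_nat_mult)
qed (use assms in \<open>simp_all add: ig_matrix_def Xvar_def\<close>)

lemma antidiagonal_product:
  assumes "i < j" "j < k" "k < d"
  shows "ig_matrix d $$ (2,i) * ig_matrix d $$ (1,j) * ig_matrix d $$ (0,k) =
    Poly_Mapping.single (antidiag_mon i j k) (of_nat (2 * j - 1))"
proof -
  obtain j' k' where "j = Suc j'" "k = Suc k'"
    using assms by (metis less_nat_zero_code not0_implies_Suc)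
  then show ?thesis using assms
    by (cases i) (simp_all add: ig_matrix_0 ig_matrix_Suc mult_single antidiag_mon_def
        del: One_nat_def of_nat_Suc of_nat_add of_nat_mult)
qed

text \<open>The zero in the middle of column 0 removes two of the six terms.\<close>

lemma ig_minor_0:
  assumes "j < k" "Suc k < d"
  shows "ig_minor d 0 (Suc j) (Suc k) =
    Poly_Mapping.single (var_mon 0 + var_mon 0 + var_mon (Suc j) + var_mon (Suc (Suc k))) (of_nat (Suc (2 * j)))
    - Poly_Mapping.single (var_mon 0 + var_mon 0 + var_mon (Suc (Suc j)) + var_mon (Suc k)) (of_nat (Suc (2 * k)))
    + Poly_Mapping.single (var_mon 1 + var_mon 1 + var_mon j + var_mon (Suc k)) (of_nat (Suc (2 * k)))
    - Poly_Mapping.single (antidiag_mon 0 (Suc j) (Suc k)) (of_nat (Suc (2 * j)))"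
  using assms
  by (simp add: ig_minor_expand ig_matrix_0 ig_matrix_Suc mult_single antidiag_mon_def
      algebra_simps del: One_nat_def of_nat_Suc of_nat_add of_nat_mult)

lemma ig_minor_Suc:
  assumes "i < j" "j < k" "Suc k < d"
  shows "ig_minor d (Suc i) (Suc j) (Suc k) =
    Poly_Mapping.single (var_mon i + var_mon (Suc j) + var_mon (Suc (Suc k))) (of_nat (Suc (2 * j)))
    - Poly_Mapping.single (var_mon i + var_mon (Suc (Suc j)) + var_mon (Suc k)) (of_nat (Suc (2 * k)))
    + Poly_Mapping.single (var_mon (Suc (Suc i)) + var_mon j + var_mon (Suc k)) (of_nat (Suc (2 * k)))
    + Poly_Mapping.single (var_mon (Suc i) + var_mon (Suc (Suc j)) + var_mon k) (of_nat (Suc (2 * i)))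
    - Poly_Mapping.single (var_mon (Suc i) + var_mon j + var_mon (Suc (Suc k))) (of_nat (Suc (2 * i)))
    - Poly_Mapping.single (antidiag_mon (Suc i) (Suc j) (Suc k)) (of_nat (Suc (2 * j)))"
  using assms
  by (simp add: ig_minor_expand ig_matrix_Suc mult_single antidiag_mon_def
      algebra_simps del: One_nat_def of_nat_Suc of_nat_add of_nat_mult)

section \<open>Comparison of the terms of a minor\<close>

lemma revlexI:
  assumes "mon_deg a = mon_deg b" "Poly_Mapping.lookup a i > Poly_Mapping.lookup b i"
    "\<And>j. j > i \<Longrightarrow> Poly_Mapping.lookup a j = Poly_Mapping.lookup b j"
  shows "revlex a b \<and> a \<noteq> b"
  using assms unfolding revlex_def by auto

text \<open>Membership bundles what is needed of the other terms of a minor: equal bidegree, which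
  makes the minor bihomogeneous, and a strictly smaller place in \<open>revlex\<close>.\<close>

definition lower_mons :: "nat \<Rightarrow> mon \<Rightarrow> mon set" where
  "lower_mons d a = {b \<in> mons d. mon_deg b = mon_deg a \<and> mon_weight b = mon_weight a \<and>
     revlex b a \<and> b \<noteq> a}"

lemma lower_monsI:
  assumes "b \<in> mons d" "mon_deg b = mon_deg a" "mon_weight b = mon_weight a"
    "Poly_Mapping.lookup b i > Poly_Mapping.lookup a i"
    "\<And>j. j > i \<Longrightarrow> Poly_Mapping.lookup b j = Poly_Mapping.lookup a j"
  shows "b \<in> lower_mons d a"
  using assms revlexI[of b a i] by (auto simp: lower_mons_def)

lemma keys_single_subset: "Poly_Mapping.keys (Poly_Mapping.single a c) \<subseteq> {a}"
  by simp

lemma keys_plus_subset: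
  "Poly_Mapping.keys p \<subseteq> A \<Longrightarrow> Poly_Mapping.keys q \<subseteq> A \<Longrightarrow> Poly_Mapping.keys (p + q) \<subseteq> A"
  using keys_add[of p q] by blast

lemma keys_minus_subset:
  "Poly_Mapping.keys p \<subseteq> A \<Longrightarrow> Poly_Mapping.keys q \<subseteq> A \<Longrightarrow>
    Poly_Mapping.keys (p - q :: 'a \<Rightarrow>\<^sub>0 'b::ab_group_add) \<subseteq> A"
  using keys_diff[of p q] by blast

text \<open>The index passed to \<open>lower_monsI\<close> is the largest one at which the two
  exponent vectors differ. The variables of the antidiagonal term have indices at most
  \<open>k - 1\<close>, while nearly every other term contains the variable \<open>k\<close> or
  \<open>k + 1\<close> and is smaller for that reason.\<close>

lemma ig_minor_decomp:
  assumes "i < j" "j < k" "k < d"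
  obtains r where "ig_minor d i j k = r - Poly_Mapping.single (antidiag_mon i j k) (of_nat (2 * j - 1))"
    "Poly_Mapping.keys r \<subseteq> lower_mons d (antidiag_mon i j k)"
proof -
  obtain j' k' where jk: "j = Suc j'" "k = Suc k'"
    using assms by (metis less_nat_zero_code not0_implies_Suc)
  note S = keys_plus_subset keys_minus_subset
  show thesis
  proof (cases i)
    case 0
    have facts: "i = 0" "j = Suc j'" "k = Suc k'" "j' < k'" "Suc k' < d" using assms jk 0 by auto
    have eq: "ig_minor d i j k + Poly_Mapping.single (antidiag_mon i j k) (of_nat (2 * j - 1)) =
      Poly_Mapping.single (var_mon 0 + var_mon 0 + var_mon (Suc j') + var_mon (Suc (Suc k'))) (of_nat (Suc (2 * j')))
      - Poly_Mapping.single (var_mon 0 + var_mon 0 + var_mon (Suc (Suc j')) + var_mon (Suc k')) (of_nat (Suc (2 * k')))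
      + Poly_Mapping.single (var_mon 1 + var_mon 1 + var_mon j' + var_mon (Suc k')) (of_nat (Suc (2 * k')))"
      (is "?l = Poly_Mapping.single ?a _ - Poly_Mapping.single ?b _ + Poly_Mapping.single ?c _")
      using facts by (simp add: ig_minor_0 del: of_nat_Suc of_nat_add of_nat_mult)
    have La: "?a \<in> lower_mons d (antidiag_mon i j k)"
      by (rule lower_monsI[of _ _ _ "k' + 2"]) (use facts in \<open>simp_all add: antidiag_mon_def lookup_add lookup_single when_def\<close>)
    have Lb: "?b \<in> lower_mons d (antidiag_mon i j k)"
      by (rule lower_monsI[of _ _ _ "k' + 1"]) (use facts in \<open>simp_all add: antidiag_mon_def lookup_add lookup_single when_def\<close>)
    have Lc: "?c \<in> lower_mons d (antidiag_mon i j k)"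
      by (rule lower_monsI[of _ _ _ "k' + 1"]) (use facts in \<open>simp_all add: antidiag_mon_def lookup_add lookup_single when_def\<close>)
    have "Poly_Mapping.keys ?l \<subseteq> lower_mons d (antidiag_mon i j k)"
      unfolding eq by (intro S order_trans[OF keys_single_subset]) (simp_all only: empty_subsetI insert_subset La Lb Lc)
    then show thesis by (intro that[of ?l]) auto
  next
    case (Suc i')
    have facts: "i = Suc i'" "j = Suc j'" "k = Suc k'" "i' < j'" "j' < k'" "Suc k' < d" using assms jk Suc by auto
    have eq: "ig_minor d i j k + Poly_Mapping.single (antidiag_mon i j k) (of_nat (2 * j - 1)) =
      Poly_Mapping.single (var_mon i' + var_mon (Suc j') + var_mon (Suc (Suc k'))) (of_nat (Suc (2 * j')))
      - Poly_Mapping.single (var_mon i' + var_mon (Suc (Suc j')) + var_mon (Suc k')) (of_nat (Suc (2 * k')))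
      + Poly_Mapping.single (var_mon (Suc (Suc i')) + var_mon j' + var_mon (Suc k')) (of_nat (Suc (2 * k')))
      + Poly_Mapping.single (var_mon (Suc i') + var_mon (Suc (Suc j')) + var_mon k') (of_nat (Suc (2 * i')))
      - Poly_Mapping.single (var_mon (Suc i') + var_mon j' + var_mon (Suc (Suc k'))) (of_nat (Suc (2 * i')))"
      (is "?l = Poly_Mapping.single ?a _ - Poly_Mapping.single ?b _ + Poly_Mapping.single ?c _
        + Poly_Mapping.single ?e _ - Poly_Mapping.single ?f _")
      using facts by (simp add: ig_minor_Suc del: of_nat_Suc of_nat_add of_nat_mult)
    have La: "?a \<in> lower_mons d (antidiag_mon i j k)"
      by (rule lower_monsI[of _ _ _ "k' + 2"]) (use facts in \<open>simp_all add: antidiag_mon_def lookup_add lookup_single when_def\<close>)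
    have Lb: "?b \<in> lower_mons d (antidiag_mon i j k)"
      by (rule lower_monsI[of _ _ _ "k' + 1"]) (use facts in \<open>simp_all add: antidiag_mon_def lookup_add lookup_single when_def\<close>)
    have Lc: "?c \<in> lower_mons d (antidiag_mon i j k)"
      by (rule lower_monsI[of _ _ _ "k' + 1"]) (use facts in \<open>simp_all add: antidiag_mon_def lookup_add lookup_single when_def\<close>)
    have Lf: "?f \<in> lower_mons d (antidiag_mon i j k)"
      by (rule lower_monsI[of _ _ _ "k' + 2"]) (use facts in \<open>simp_all add: antidiag_mon_def lookup_add lookup_single when_def\<close>)
    \<comment> \<open>This term shares its variable \<open>k'\<close> with the antidiagonal term, so
      the comparison is decided by the other two variables. The larger of them has index
      \<open>j' + 2\<close> here and \<open>j' + 1\<close> in the antidiagonal term.\<close>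
    have Le: "?e \<in> lower_mons d (antidiag_mon i j k)"
      by (rule lower_monsI[of _ _ _ "j' + 2"]) (use facts in \<open>simp_all add: antidiag_mon_def lookup_add lookup_single when_def\<close>)
    have "Poly_Mapping.keys ?l \<subseteq> lower_mons d (antidiag_mon i j k)"
      unfolding eq by (intro S order_trans[OF keys_single_subset]) (simp_all only: empty_subsetI insert_subset La Lb Lc Le Lf)
    then show thesis by (intro that[of ?l]) auto
  qed
qed

lemma lookup_ig_minor_antidiag:
  assumes "i < j" "j < k" "k < d"
  shows "Poly_Mapping.lookup (ig_minor d i j k) (antidiag_mon i j k) = - of_nat (2 * j - 1)"
proof -
  obtain r where r: "ig_minor d i j k =
      r - Poly_Mapping.single (antidiag_mon i j k) (of_nat (2 * j - 1))"
    "Poly_Mapping.keys r \<subseteq> lower_mons d (antidiag_mon i j k)"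
    using ig_minor_decomp[OF assms] .
  have "Poly_Mapping.lookup r (antidiag_mon i j k) = 0"
    using r(2) by (auto simp: lower_mons_def in_keys_iff)
  then show ?thesis by (simp add: r(1) lookup_minus)
qed

lemma antidiag_mon_in_keys:
  assumes "i < j" "j < k" "k < d"
  shows "antidiag_mon i j k \<in> Poly_Mapping.keys (ig_minor d i j k)"
proof -
  have "(of_nat (2 * j - 1) :: complex) \<noteq> 0"
    by (subst of_nat_eq_0_iff) (use assms in auto)
  then show ?thesis
    by (simp only: in_keys_iff lookup_ig_minor_antidiag[OF assms] neg_equal_0_iff_equal not_False_eq_True)
qed

lemma antidiag_mon_mons:
  assumes "i < j" "j < k" "k < d"
  shows "antidiag_mon i j k \<in> mons d"
  using assms by (auto simp: antidiag_mon_def)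

lemma keys_ig_minor:
  assumes "i < j" "j < k" "k < d"
  shows "Poly_Mapping.keys (ig_minor d i j k) \<subseteq>
    insert (antidiag_mon i j k) (lower_mons d (antidiag_mon i j k))"
proof -
  obtain r where r: "ig_minor d i j k =
      r - Poly_Mapping.single (antidiag_mon i j k) (of_nat (2 * j - 1))"
    "Poly_Mapping.keys r \<subseteq> lower_mons d (antidiag_mon i j k)"
    using ig_minor_decomp[OF assms] .
  show ?thesis unfolding r(1)
    using keys_minus_subset[of r _ "Poly_Mapping.single (antidiag_mon i j k) (of_nat (2 * j - 1))"] r(2)
      keys_single_subset[of "antidiag_mon i j k"]
    by blast
qed

section \<open>The reverse lexicographic order is antidiagonal\<close>

lemma mon_deg_eq_0_iff: "mon_deg a = 0 \<longleftrightarrow> a = 0"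
  by (auto simp: mon_deg_def in_keys_iff poly_mapping_eq_iff fun_eq_iff)

lemma revlex_total: "revlex a b \<or> revlex b a"
proof (cases "a = b \<or> mon_deg a \<noteq> mon_deg b")
  case True
  then show ?thesis by (auto simp: revlex_def)
next
  case False
  define D where "D = {i. Poly_Mapping.lookup a i \<noteq> Poly_Mapping.lookup b i}"
  have "D \<subseteq> Poly_Mapping.keys a \<union> Poly_Mapping.keys b"
    by (auto simp: D_def in_keys_iff)
  then have "finite D" by (rule finite_subset) simp
  have "D \<noteq> {}"
  proof
    assume "D = {}"
    then have "a = b" by (intro poly_mapping_eqI) (auto simp: D_def)
    then show False using False by simp
  qed
  have m: "Max D \<in> D" using \<open>finite D\<close> \<open>D \<noteq> {}\<close> by simp
  have "\<forall>j>Max D. Poly_Mapping.lookup a j = Poly_Mapping.lookup b j"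
  proof (intro allI impI, rule ccontr)
    fix j assume "j > Max D" "Poly_Mapping.lookup a j \<noteq> Poly_Mapping.lookup b j"
    then show False using Max_ge[OF \<open>finite D\<close>, of j] by (simp add: D_def)
  qed
  moreover have "Poly_Mapping.lookup a (Max D) \<noteq> Poly_Mapping.lookup b (Max D)"
    using m by (simp add: D_def)
  ultimately show ?thesis using False unfolding revlex_def
    by (metis linorder_neqE_nat)
qed

lemma revlex_antisym:
  assumes "revlex a b" "revlex b a" shows "a = b"
proof (rule ccontr)
  assume "a \<noteq> b"
  then obtain i k where
    i: "Poly_Mapping.lookup a i > Poly_Mapping.lookup b i"
      "\<forall>j>i. Poly_Mapping.lookup a j = Poly_Mapping.lookup b j" and
    k: "Poly_Mapping.lookup b k > Poly_Mapping.lookup a k"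
      "\<forall>j>k. Poly_Mapping.lookup b j = Poly_Mapping.lookup a j"
    using assms unfolding revlex_def by (metis less_asym less_irrefl)
  show False
    using i(1) k(1) i(2)[rule_format, of k] k(2)[rule_format, of i]
    by (cases i k rule: linorder_cases) auto
qed

lemma revlex_trans:
  assumes "revlex a b" "revlex b c" shows "revlex a c"
proof (cases "a = b \<or> b = c \<or> mon_deg a < mon_deg c")
  case True
  then show ?thesis using assms by (auto simp: revlex_def)
next
  case False
  with assms obtain i k where
    i: "Poly_Mapping.lookup a i > Poly_Mapping.lookup b i"
      "\<forall>j>i. Poly_Mapping.lookup a j = Poly_Mapping.lookup b j" and
    k: "Poly_Mapping.lookup b k > Poly_Mapping.lookup c k"
      "\<forall>j>k. Poly_Mapping.lookup b j = Poly_Mapping.lookup c j"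
    and deg: "mon_deg a = mon_deg c"
    unfolding revlex_def by (metis order.strict_trans)
  have "Poly_Mapping.lookup a (max i k) > Poly_Mapping.lookup c (max i k)"
    using i(1) k(1) i(2)[rule_format, of k] k(2)[rule_format, of i]
    by (cases i k rule: linorder_cases) (auto simp: max_def)
  moreover have "\<forall>j>max i k. Poly_Mapping.lookup a j = Poly_Mapping.lookup c j"
    using i k by auto
  ultimately show ?thesis using deg by (auto simp: revlex_def)
qed

lemma revlex_monomial_order: "monomial_order d revlex"
proof -
  have "revlex 0 a" for a
    by (cases "a = 0") (auto simp: revlex_def simp flip: mon_deg_eq_0_iff)
  moreover have "revlex (a + c) (b + c)" if "revlex a b" for a b c
    using that by (auto simp: revlex_def lookup_add)
  ultimately show ?thesis
    unfolding monomial_order_def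
    using revlex_total revlex_antisym revlex_trans by blast
qed

lemma revlex_antidiagonal_order: "antidiagonal_order d revlex"
  unfolding antidiagonal_order_def
proof (intro conjI allI impI revlex_monomial_order, elim conjE)
  fix i j k assume ijk: "i < j" "j < k" "k < d"
  show "\<exists>a s. is_initial_mon revlex (ig_minor d i j k) a \<and> s \<noteq> 0 \<and>
    ig_matrix d $$ (2, i) * ig_matrix d $$ (1, j) * ig_matrix d $$ (0, k) = Poly_Mapping.single a s"
  proof (intro exI conjI)
    show "is_initial_mon revlex (ig_minor d i j k) (antidiag_mon i j k)"
      using antidiag_mon_in_keys[OF ijk] keys_ig_minor[OF ijk]
      by (auto simp: is_initial_mon_def lower_mons_def revlex_def)
    show "(of_nat (2 * j - 1) :: complex) \<noteq> 0"
      by (subst of_nat_eq_0_iff) (use ijk in auto)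
  qed (rule antidiagonal_product[OF ijk])
qed

text \<open>The coefficient of the antidiagonal product is nonzero, so the product determines its
  monomial. Hence all antidiagonal orders select the same initial monomials of the minors, and the
  standard monomials can be defined without mentioning an order.\<close>

lemma antidiagonal_order_initial:
  assumes "antidiagonal_order d leq" "i < j" "j < k" "k < d"
  shows "is_initial_mon leq (ig_minor d i j k) (antidiag_mon i j k)"
proof -
  obtain a s where a: "is_initial_mon leq (ig_minor d i j k) a" "s \<noteq> 0"
    "ig_matrix d $$ (2, i) * ig_matrix d $$ (1, j) * ig_matrix d $$ (0, k) = Poly_Mapping.single a s"
    using assms unfolding antidiagonal_order_def by blast
  have "Poly_Mapping.single (antidiag_mon i j k) (of_nat (2 * j - 1)) = Poly_Mapping.single a s"
    using a(3) antidiagonal_product[OF assms(2-4)] by simp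
  from arg_cong[OF this, of "\<lambda>p. Poly_Mapping.lookup p a"] a(2)
  have "antidiag_mon i j k = a"
    by (auto simp: lookup_single when_def split: if_splits)
  then show ?thesis using a(1) by simp
qed

section \<open>Restriction to the curve\<close>

text \<open>The moments for \<open>\<mu> = x\<close>, \<open>\<lambda> = x\<^sup>2\<close>. In general, \<open>\<mu> = s x\<close> and \<open>\<lambda> = s x\<^sup>2\<close> with
  \<open>s = \<mu>\<^sup>2 / \<lambda>\<close>, and the moment of index \<open>i\<close> is homogeneous of degree \<open>i\<close> in \<open>s\<close>.\<close>

fun curve_poly :: "nat \<Rightarrow> complex poly" where
  "curve_poly 0 = 1"
| "curve_poly (Suc 0) = [:0, 1:]"
| "curve_poly (Suc (Suc n)) =
     smult (of_nat (2 * n + 1)) (curve_poly (Suc n)) + [:0, 0, 1:] * curve_poly n"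

text \<open>For \<open>i \<ge> 1\<close> these polynomials are \<open>x\<close> times the reverse
  Bessel polynomial of degree \<open>i - 1\<close>. The summand with factor \<open>x^2\<close> does
  not reach the linear coefficient, which is therefore the product of the odd numbers up to
  \<open>2 i - 3\<close>.\<close>

lemma curve_poly_coeff:
  assumes "i \<ge> 1"
  shows "coeff (curve_poly i) 0 = 0 \<and> coeff (curve_poly i) 1 \<noteq> 0"
  using assms
proof (induction i rule: curve_poly.induct)
  case (3 n)
  have "(of_nat (2 * n + 1) :: complex) \<noteq> 0"
    by (subst of_nat_eq_0_iff) auto
  moreover have "curve_poly (Suc (Suc n)) = smult (of_nat (2 * n + 1)) (curve_poly (Suc n))
      + pCons 0 (pCons 0 (curve_poly n))"
    by simp
  ultimately show ?case using 3
    by (simp del: curve_poly.simps of_nat_add of_nat_mult of_nat_Suc)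
qed auto

lemma ig_moment_curve:
  assumes "x \<noteq> 0" "s \<noteq> 0"
  shows "ig_moment (s * x) (s * x\<^sup>2) i = s ^ i * poly (curve_poly i) x"
proof (induction i rule: curve_poly.induct)
  case (3 n)
  have "(s * x)\<^sup>2 / (s * x\<^sup>2) = s"
    using assms by (simp add: field_simps power2_eq_square)
  then have "of_nat (2 * (n + 2) - 3) / (s * x\<^sup>2) * (s * x)\<^sup>2 = of_nat (2 * (n + 2) - 3) * s"
    by (metis times_divide_eq_left times_divide_eq_right)
  moreover have "2 * (n + 2) - 3 = 2 * n + 1" by simp
  ultimately have "ig_moment (s * x) (s * x\<^sup>2) (Suc (Suc n)) = of_nat (2 * n + 1) * s
      * (s ^ Suc n * poly (curve_poly (Suc n)) x) + (s * x)\<^sup>2 * (s ^ n * poly (curve_poly n) x)"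
    by (simp only: ig_moment.simps 3)
  then show ?case
    by (simp add: algebra_simps power2_eq_square del: ig_moment.simps of_nat_add of_nat_mult of_nat_Suc)
qed auto

text \<open>The parameter \<open>\<mu> = 0\<close> escapes \<open>ig_moment_curve\<close>, where
  \<open>x\<close> must be nonzero. It corresponds to the point of the curve at
  \<open>x = 0\<close>.\<close>

lemma ig_moment_0: "ig_moment 0 l i = poly (curve_poly i) 0"
proof (induction i rule: curve_poly.induct)
  case (3 n)
  have "coeff (curve_poly (Suc n)) 0 = 0" using curve_poly_coeff[of "Suc n"] by simp
  then show ?case by (simp add: poly_0_coeff_0)
qed auto

section \<open>Vanishing of the minors on the curve\<close>

abbreviation curve_mon :: "mon \<Rightarrow> complex poly" where
  "curve_mon \<equiv> mon_eval curve_poly"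

text \<open>In the columns \<open>c \<ge> 1\<close> this is the recurrence of the moments, since
  \<open>2 c - 1\<close> is the coefficient that produces the polynomial of index
  \<open>c + 1\<close>. In column 0 it says that the square of \<open>x\<close> equals
  \<open>x^2\<close>. The rows are thus linearly dependent, which kills every minor.\<close>

lemma eval_ig_matrix:
  fixes x :: complex
  assumes "c < d"
  defines "p \<equiv> \<lambda>i. poly (curve_poly i) x"
  shows "eval_poly p (ig_matrix d $$ (2, c)) = eval_poly p (ig_matrix d $$ (1, c))
    + x\<^sup>2 * eval_poly p (ig_matrix d $$ (0, c))"
proof (cases c)
  case 0
  then have "0 < d" using assms by simp
  show ?thesis unfolding 0 ig_matrix_0[OF \<open>0 < d\<close>]
    by (simp add: p_def power2_eq_square)
next
  case (Suc c')
  then show ?thesis using assms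
    by (simp add: ig_matrix_Suc del: One_nat_def of_nat_Suc)
       (simp add: algebra_simps power2_eq_square)
qed

lemma eval_ig_minor_curve:
  assumes "i < j" "j < k" "k < d"
  shows "eval_poly (\<lambda>i. poly (curve_poly i) x) (ig_minor d i j k) = 0"
  using assms
  by (simp add: ig_minor_expand eval_ig_matrix algebra_simps)

lemma sum_ig_minor_curve:
  assumes "i < j" "j < k" "k < d"
  shows "(\<Sum>a\<in>Poly_Mapping.keys (ig_minor d i j k).
    smult (Poly_Mapping.lookup (ig_minor d i j k) a) (curve_mon a)) = 0" (is "?p = 0")
proof -
  have "poly ?p x = 0" for x
    using eval_ig_minor_curve[OF assms, of x]
    by (simp add: eval_poly_alt poly_sum poly_mon_eval)
  then show ?thesis by (simp add: poly_eq_poly_eq_iff[symmetric] fun_eq_iff)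
qed

section \<open>Standard monomials\<close>

definition std_mons :: "nat \<Rightarrow> mon set" where
  "std_mons d = {a \<in> mons d. \<forall>i j k. i < j \<and> j < k \<and> k < d \<longrightarrow> (\<forall>e. a \<noteq> antidiag_mon i j k + e)}"

text \<open>These will turn out to be the standard monomials in the variables
  \<open>1, ..., d - 2\<close>, the only ones that occur in antidiagonal terms. Those terms are all
  cubic monomials in the variables from 2 on, and the square of the variable 1 times all quadratic
  monomials. What avoids them has degree at most 3 and, in degree 3, contains the variable
  1.\<close>

definition core_mons :: "nat \<Rightarrow> mon set" where
  "core_mons d = {0} \<union> {var_mon a | a. 1 \<le> a \<and> a \<le> d - 2}
     \<union> {var_mon a + var_mon b | a b. 1 \<le> a \<and> a \<le> b \<and> b \<le> d - 2}
     \<union> {var_mon 1 + var_mon a + var_mon b | a b. 1 \<le> a \<and> a \<le> b \<and> b \<le> d - 2}"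

lemma mon_split_var:
  fixes a :: mon
  obtains b where "a = Poly_Mapping.single i (Poly_Mapping.lookup a i) + b"
    "Poly_Mapping.keys b = Poly_Mapping.keys a - {i}"
proof
  show "a = Poly_Mapping.single i (Poly_Mapping.lookup a i) + Poly_Mapping.update i 0 a"
    by (rule poly_mapping_eqI) (simp add: lookup_add lookup_single lookup_update when_def)
qed (simp add: keys_update)

lemma mon_split_min:
  fixes a :: mon
  assumes "a \<noteq> 0"
  obtains i b where "a = var_mon i + b" "i \<in> Poly_Mapping.keys a"
    "Poly_Mapping.keys b \<subseteq> Poly_Mapping.keys a" "\<And>j. j \<in> Poly_Mapping.keys a \<Longrightarrow> i \<le> j"
proof
  let ?i = "Min (Poly_Mapping.keys a)"
  show i: "?i \<in> Poly_Mapping.keys a" using assms by (intro Min_in) auto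
  then show "a = var_mon ?i + (a - var_mon ?i)"
    by (intro poly_mapping_eqI) (auto simp: lookup_add lookup_minus lookup_single when_def in_keys_iff)
  show "Poly_Mapping.keys (a - var_mon ?i) \<subseteq> Poly_Mapping.keys a"
    by (auto simp: in_keys_iff lookup_minus)
qed auto

lemma std_mons_notI:
  assumes "a = antidiag_mon i j k + e" "i < j" "j < k" "k < d"
  shows "a \<notin> std_mons d"
  using assms unfolding std_mons_def by blast

text \<open>Smallest variables \<open>a \<le> b \<le> c \<le> f\<close> are peeled off one at a
  time. If \<open>a \<ge> 2\<close>, the first three form the antidiagonal term of the columns
  \<open>a - 1\<close>, \<open>b\<close>, \<open>c + 1\<close>, so a third variable forces
  \<open>a = 1\<close>. A fourth variable is impossible: for \<open>b = 1\<close> the term of the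
  columns \<open>0\<close>, \<open>c\<close>, \<open>f + 1\<close> divides, for
  \<open>b \<ge> 2\<close> that of the columns \<open>b - 1\<close>, \<open>c\<close>,
  \<open>f + 1\<close>. The factor \<open>e\<close> carries the remaining variables along.\<close>

lemma std_mons_core:
  assumes "d \<ge> 3" "m + e \<in> std_mons d" "Poly_Mapping.keys m \<subseteq> {1..d-2}"
  shows "m \<in> core_mons d"
proof (cases "m = 0")
  case False
  then obtain a m1 where 1: "m = var_mon a + m1" "a \<in> Poly_Mapping.keys m"
    "Poly_Mapping.keys m1 \<subseteq> Poly_Mapping.keys m" "\<And>j. j \<in> Poly_Mapping.keys m \<Longrightarrow> a \<le> j"
    by (rule mon_split_min) blast
  have a: "1 \<le> a" "a \<le> d - 2" using 1 assms by auto
  show ?thesis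
  proof (cases "m1 = 0")
    case True
    then show ?thesis using 1 a unfolding core_mons_def by auto
  next
    case False
    then obtain b m2 where 2: "m1 = var_mon b + m2" "b \<in> Poly_Mapping.keys m1"
      "Poly_Mapping.keys m2 \<subseteq> Poly_Mapping.keys m1" "\<And>j. j \<in> Poly_Mapping.keys m1 \<Longrightarrow> b \<le> j"
      by (rule mon_split_min) blast
    have b: "a \<le> b" "b \<le> d - 2" using 1 2 assms by auto
    show ?thesis
    proof (cases "m2 = 0")
      case True
      then have "m = var_mon a + var_mon b" using 1 2 by simp
      then show ?thesis using a b unfolding core_mons_def by blast
    next
      case False
      then obtain c m3 where 3: "m2 = var_mon c + m3" "c \<in> Poly_Mapping.keys m2"
        "Poly_Mapping.keys m3 \<subseteq> Poly_Mapping.keys m2" "\<And>j. j \<in> Poly_Mapping.keys m2 \<Longrightarrow> c \<le> j"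
        by (rule mon_split_min) blast
      have c: "b \<le> c" "c \<le> d - 2" using 1(3) 2(3,4) 3(2) assms(3) by fastforce+
      have "a = 1"
      proof (rule ccontr)
        assume "a \<noteq> 1"
        then have "m + e = antidiag_mon (a - 1) b (c + 1) + (m3 + e)"
          using a by (simp add: 1(1) 2(1) 3(1) antidiag_mon_def add.assoc)
        then show False
          using std_mons_notI[of _ "a - 1" b "c + 1"] a b c assms(1,2) by auto
      qed
      show ?thesis
      proof (cases "m3 = 0")
        case True
        then have "m = var_mon 1 + var_mon b + var_mon c"
          using 1 2 3 \<open>a = 1\<close> by (simp add: add.assoc)
        then show ?thesis using a b c unfolding core_mons_def by (blast intro: order_trans)
      next
        case False
        then obtain f m4 where 4: "m3 = var_mon f + m4" "f \<in> Poly_Mapping.keys m3"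
          by (rule mon_split_min) blast
        have f: "c \<le> f" "f \<le> d - 2" using 1(3) 2(3) 3(3,4) 4(2) assms(3) by fastforce+
        have False
        proof (cases "b = 1")
          case True
          then have "m + e = antidiag_mon 0 c (f + 1) + (m4 + e)"
            using \<open>a = 1\<close> by (simp add: 1(1) 2(1) 3(1) 4(1) antidiag_mon_def add.assoc)
          then show False
            using std_mons_notI[of _ 0 c "f + 1"] a b c f assms(1,2) by auto
        next
          case False
          then have "m + e = antidiag_mon (b - 1) c (f + 1) + (var_mon a + m4 + e)"
            using a b by (simp add: 1(1) 2(1) 3(1) 4(1) antidiag_mon_def add.assoc add.left_commute)
          then show False
            using std_mons_notI[of _ "b - 1" c "f + 1"] a b c f False assms(1,2) by auto
        qed
        then show ?thesis ..
      qed
    qed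
  qed
qed (simp add: core_mons_def)

lemma std_mons_decomp:
  assumes "d \<ge> 3" "a \<in> std_mons d"
  obtains n p q m where
    "a = Poly_Mapping.single 0 n + Poly_Mapping.single (d - 1) p + Poly_Mapping.single d q + m"
    "m \<in> core_mons d"
proof -
  obtain b where b: "a = Poly_Mapping.single 0 (Poly_Mapping.lookup a 0) + b"
    "Poly_Mapping.keys b = Poly_Mapping.keys a - {0}" by (rule mon_split_var)
  obtain c where c: "b = Poly_Mapping.single (d-1) (Poly_Mapping.lookup b (d-1)) + c"
    "Poly_Mapping.keys c = Poly_Mapping.keys b - {d-1}" by (rule mon_split_var)
  obtain m where m: "c = Poly_Mapping.single d (Poly_Mapping.lookup c d) + m"
    "Poly_Mapping.keys m = Poly_Mapping.keys c - {d}" by (rule mon_split_var)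
  have eq: "a = Poly_Mapping.single 0 (Poly_Mapping.lookup a 0)
      + Poly_Mapping.single (d-1) (Poly_Mapping.lookup b (d-1))
      + Poly_Mapping.single d (Poly_Mapping.lookup c d) + m"
    by (metis add.assoc b(1) c(1) m(1))
  have "Poly_Mapping.keys a \<subseteq> {..d}" using assms by (simp add: std_mons_def mons_def)
  then have "Poly_Mapping.keys m \<subseteq> {1..d-2}"
    using assms(1) unfolding m(2) c(2) b(2) by (force simp: le_less)
  moreover have "m + (Poly_Mapping.single 0 (Poly_Mapping.lookup a 0)
      + Poly_Mapping.single (d-1) (Poly_Mapping.lookup b (d-1))
      + Poly_Mapping.single d (Poly_Mapping.lookup c d)) \<in> std_mons d"
    using assms(2) eq by (metis add.commute)
  ultimately have "m \<in> core_mons d" by (intro std_mons_core[OF assms(1)])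
  then show thesis using that eq by blast
qed

lemma core_mons_keys:
  assumes "m \<in> core_mons d" shows "Poly_Mapping.keys m \<subseteq> {1..d-2}"
  using assms unfolding core_mons_def by (auto simp: keys_add_mon)

text \<open>Enumerates the core monomials by the pairs \<open>(u, r)\<close> with \<open>u < d\<close>, \<open>u \<noteq> 1\<close>, \<open>r < d - 1\<close>
  in such a way that the weight is \<open>u + r\<close>; the index 0 stands for the factor 1.\<close>

definition core_of :: "nat \<Rightarrow> nat \<Rightarrow> mon" where
  "core_of u r = (let nz = (\<lambda>i. if i = 0 then 0 else var_mon i) in
     if u \<le> r then nz u + nz r else if r = 0 then var_mon 1 + var_mon (u - 1)
     else var_mon 1 + var_mon r + var_mon (u - 1))"

text \<open>Since \<open>u = 1\<close> is excluded, a quadratic monomial with the variable 1 cannot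
  be coded by its two indices. It is moved to the branch \<open>u > r\<close>, where the code
  \<open>u = b + 1\<close> accounts for the variables 1 and \<open>b\<close> together and so
  preserves the weight; cubic monomials use the same shift.\<close>

lemma core_of_surj:
  assumes "d \<ge> 3" "m \<in> core_mons d"
  obtains u r where "u < d" "u \<noteq> 1" "r < d - 1" "core_of u r = m" "mon_weight m = u + r"
proof -
  consider "m = 0" | a where "m = var_mon a" "1 \<le> a" "a \<le> d - 2"
    | a b where "m = var_mon a + var_mon b" "1 \<le> a" "a \<le> b" "b \<le> d - 2"
    | a b where "m = var_mon 1 + var_mon a + var_mon b" "1 \<le> a" "a \<le> b" "b \<le> d - 2"
    using assms(2) unfolding core_mons_def by blast
  then show thesis
  proof cases
    case 1
    then show thesis using assms(1) by (intro that[of 0 0]) (simp_all add: core_of_def)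
  next
    case (2 a)
    then show thesis using assms(1) by (intro that[of 0 a]) (simp_all add: core_of_def Let_def)
  next
    case (3 a b)
    show thesis
    proof (cases "a = 1")
      case True
      then show thesis using assms(1) 3
        by (intro that[of "b + 1" 0]) (simp_all add: core_of_def Let_def)
    next
      case False
      then show thesis using assms(1) 3
        by (intro that[of a b]) (simp_all add: core_of_def Let_def)
    qed
  next
    case (4 a b)
    then show thesis using assms(1)
      by (intro that[of "b + 1" a]) (simp_all add: core_of_def Let_def)
  qed
qed

section \<open>Counting standard monomials in a bidegree\<close>

definition std_bi :: "nat \<Rightarrow> nat \<Rightarrow> nat \<Rightarrow> mon set" where
  "std_bi d n w = {a \<in> std_mons d. mon_deg a = n \<and> mon_weight a = w}"

lemma finite_mons_deg: "finite {a \<in> mons d. mon_deg a = n}"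
proof -
  let ?M = "{a \<in> mons d. mon_deg a = n}"
  let ?f = "\<lambda>a :: mon. restrict (Poly_Mapping.lookup a) {..d}"
  have "Poly_Mapping.lookup a i \<le> mon_deg a" for a i
    by (cases "i \<in> Poly_Mapping.keys a")
      (auto simp: mon_deg_def in_keys_iff intro: member_le_sum)
  then have "?f ` ?M \<subseteq> PiE {..d} (\<lambda>_. {..n})"
    by (auto simp: PiE_iff split: if_splits)
  then have "finite (?f ` ?M)" by (rule finite_subset) (simp add: finite_PiE)
  moreover have "inj_on ?f ?M"
  proof (rule inj_onI, rule poly_mapping_eqI)
    fix a b i assume ab: "a \<in> ?M" "b \<in> ?M" "?f a = ?f b"
    show "Poly_Mapping.lookup a i = Poly_Mapping.lookup b i"
    proof (cases "i \<le> d")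
      case True
      then show ?thesis using fun_cong[OF ab(3), of i] by simp
    next
      case False
      then have "i \<notin> Poly_Mapping.keys a" "i \<notin> Poly_Mapping.keys b"
        using ab by (auto simp: mons_def)
      then show ?thesis by (simp add: in_keys_iff)
    qed
  qed
  ultimately show ?thesis using finite_imageD by blast
qed

lemma finite_std_bi: "finite (std_bi d n w)"
  by (rule finite_subset[OF _ finite_mons_deg[of d n]]) (auto simp: std_bi_def std_mons_def)

text \<open>The numbers up to \<open>w\<close> that are 1 modulo \<open>d\<close> are the numbers
  \<open>1 + d * k\<close> with \<open>d * k < w\<close>. Both sides are therefore complements in
  \<open>{..w}\<close> of sets of the same size.\<close>

lemma card_residue_complement:
  fixes d w :: nat
  assumes "d \<ge> 2"
  shows "card {y. y \<le> w \<and> y mod d \<noteq> 1} = card {b. b \<le> w \<and> w \<le> d * b}"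
proof -
  let ?f = "\<lambda>k. 1 + d * k"
  have *: "{y. y \<le> w \<and> y mod d = 1} = ?f ` {b. b \<le> w \<and> d * b < w}"
  proof (intro Set.set_eqI iffI)
    fix y assume "y \<in> {y. y \<le> w \<and> y mod d = 1}"
    then have y: "y \<le> w" "y = 1 + d * (y div d)" using mod_mult_div_eq[of y d] by auto
    then have "d * (y div d) < w" "y div d \<le> w" using div_le_dividend[of y d] by linarith+
    then show "y \<in> ?f ` {b. b \<le> w \<and> d * b < w}" using y(2) by blast
  qed (use assms in \<open>auto simp: mod_Suc\<close>)
  have "inj_on ?f {b. b \<le> w \<and> d * b < w}" using assms by (auto simp: inj_on_def)
  then have c: "card {y. y \<le> w \<and> y mod d = 1} = card {b. b \<le> w \<and> d * b < w}"
    unfolding * by (rule card_image)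
  have "{y. y \<le> w \<and> y mod d \<noteq> 1} = {..w} - {y. y \<le> w \<and> y mod d = 1}"
    "{b. b \<le> w \<and> w \<le> d * b} = {..w} - {b. b \<le> w \<and> d * b < w}" by auto
  then show ?thesis using c by (simp add: card_Diff_subset subset_eq)
qed

text \<open>Let \<open>p\<close> and \<open>q\<close> be the exponents of the variables
  \<open>d - 1\<close> and \<open>d\<close>, and let \<open>u\<close>, \<open>r\<close> code the
  core. The single number \<open>y = u + d * q\<close> recovers everything: \<open>u\<close> and
  \<open>q\<close> by division by \<open>d\<close>, and \<open>r\<close> and \<open>p\<close> by
  dividing \<open>w - y = r + (d - 1) * p\<close> by \<open>d - 1\<close>. The exponent of the
  variable 0 then follows from the degree. The restriction \<open>u \<noteq> 1\<close> becomes
  \<open>y mod d \<noteq> 1\<close>.\<close>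

lemma card_std_bi_le:
  assumes "d \<ge> 3"
  shows "card (std_bi d n w) \<le> card {b. b \<le> w \<and> w \<le> d * b}"
proof -
  define body where "body y = Poly_Mapping.single (d - 1) ((w - y) div (d - 1))
    + Poly_Mapping.single d (y div d) + core_of (y mod d) ((w - y) mod (d - 1))" for y
  let ?Y = "{y. y \<le> w \<and> y mod d \<noteq> 1}"
  let ?F = "\<lambda>y. Poly_Mapping.single 0 (n - mon_deg (body y)) + body y"
  have "std_bi d n w \<subseteq> ?F ` ?Y"
  proof
    fix a assume a: "a \<in> std_bi d n w"
    then obtain z p q m where
      eq: "a = Poly_Mapping.single 0 z + Poly_Mapping.single (d - 1) p + Poly_Mapping.single d q + m"
      and "m \<in> core_mons d"
      using std_mons_decomp[OF assms, of a] unfolding std_bi_def by blast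
    then obtain u r where ur: "u < d" "u \<noteq> 1" "r < d - 1" "core_of u r = m" "mon_weight m = u + r"
      using core_of_surj[OF assms] by blast
    let ?y = "u + d * q"
    have w: "w = (d - 1) * p + d * q + (u + r)"
      using a by (simp add: std_bi_def eq ur(5))
    then have "w - ?y = r + (d - 1) * p" by simp
    then have b: "body ?y = Poly_Mapping.single (d - 1) p + Poly_Mapping.single d q + m"
      unfolding body_def using ur by simp
    have "mon_deg a = n" using a by (simp add: std_bi_def)
    then have "n - mon_deg (body ?y) = z" unfolding b eq by simp
    then have "a = ?F ?y" unfolding b eq by (simp add: add.assoc)
    moreover have "?y \<in> ?Y" using ur w by simp
    ultimately show "a \<in> ?F ` ?Y" by blast
  qed
  then have "card (std_bi d n w) \<le> card (?F ` ?Y)" by (intro card_mono) auto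
  also have "\<dots> \<le> card ?Y" by (intro card_image_le) auto
  also have "\<dots> = card {b. b \<le> w \<and> w \<le> d * b}"
    using assms by (intro card_residue_complement) simp
  finally show ?thesis .
qed

section \<open>Linear independence of the standard monomials\<close>

interpretation pvs: vector_space "smult :: complex \<Rightarrow> complex poly \<Rightarrow> complex poly"
  by unfold_locales (simp_all add: smult_add_right smult_add_left)

lemma monomial_orderD:
  assumes "monomial_order d leq" "a \<in> mons d" "b \<in> mons d"
  shows "leq a a" "leq a b \<or> leq b a" "leq a b \<Longrightarrow> leq b a \<Longrightarrow> a = b"
    "c \<in> mons d \<Longrightarrow> leq a b \<Longrightarrow> leq b c \<Longrightarrow> leq a c"
    "c \<in> mons d \<Longrightarrow> leq a b \<Longrightarrow> leq (a + c) (b + c)"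
  using assms unfolding monomial_order_def by blast+

text \<open>Induction runs over the number of monomials of the same bidegree that are not larger
  than \<open>a\<close>. This number is finite because the degree is fixed, so well-foundedness of
  the order does not have to be established. The bound \<open>leq b a\<close> on the monomials used
  is what later controls initial monomials.\<close>

lemma curve_mon_in_span_std:
  assumes ado: "antidiagonal_order d leq" and "a \<in> mons d"
  shows "curve_mon a \<in> pvs.span (curve_mon `
    {b \<in> std_bi d (mon_deg a) (mon_weight a). leq b a})"
proof -
  have mo: "monomial_order d leq" using ado by (simp add: antidiagonal_order_def)
  define below where "below a = {b \<in> mons d. mon_deg b = mon_deg a \<and>
    mon_weight b = mon_weight a \<and> leq b a}" for a
  have fin: "finite (below a)" for a
    by (rule finite_subset[OF _ finite_mons_deg[of d "mon_deg a"]]) (auto simp: below_def)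
  define T where "T a = curve_mon ` {b \<in> std_bi d (mon_deg a) (mon_weight a). leq b a}" for a
  have "curve_mon a \<in> pvs.span (T a)" using \<open>a \<in> mons d\<close>
  proof (induction "card (below a)" arbitrary: a rule: less_induct)
    case less
    show ?case
    proof (cases "a \<in> std_mons d")
      case True
      then show ?thesis
        using monomial_orderD(1)[OF mo less.prems less.prems]
        by (intro pvs.span_base) (auto simp: T_def std_bi_def)
    next
      case False
      then obtain i j k e where ijk: "i < j" "j < k" "k < d" and a: "a = antidiag_mon i j k + e"
        using less.prems by (auto simp: std_mons_def)
      let ?g = "ig_minor d i j k" and ?m = "antidiag_mon i j k"
      have e: "e \<in> mons d" using less.prems a by simp
      have keys: "b \<in> mons d" "mon_deg b = mon_deg ?m" "mon_weight b = mon_weight ?m" "leq b ?m"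
        if "b \<in> Poly_Mapping.keys ?g" for b
        using that keys_ig_minor[OF ijk] antidiag_mon_mons[OF ijk]
          antidiagonal_order_initial[OF ado ijk]
        by (auto simp: lower_mons_def is_initial_mon_def)
      have IH: "curve_mon (b + e) \<in> pvs.span (T a)" if b: "b \<in> Poly_Mapping.keys ?g - {?m}" for b
      proof -
        have be: "b + e \<in> mons d" using keys(1)[of b] e b by simp
        have le: "leq (b + e) a"
          unfolding a using b keys[of b] e antidiag_mon_mons[OF ijk]
          by (intro monomial_orderD(5)[OF mo]) auto
        have "a \<notin> below (b + e)"
          using monomial_orderD(3)[OF mo less.prems be] le b unfolding below_def a by auto
        moreover have "a \<in> below a"
          using less.prems monomial_orderD(1)[OF mo less.prems] by (auto simp: below_def)
        moreover have bi: "mon_deg (b + e) = mon_deg a" "mon_weight (b + e) = mon_weight a"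
          using keys[of b] b by (auto simp: a)
        have "below (b + e) \<subseteq> below a"
          using monomial_orderD(4)[OF mo _ be less.prems] le unfolding below_def bi by auto
        ultimately have "card (below (b + e)) < card (below a)"
          by (intro psubset_card_mono fin) auto
        then have "curve_mon (b + e) \<in> pvs.span (T (b + e))" using less.hyps be by blast
        moreover have "T (b + e) \<subseteq> T a"
          using monomial_orderD(4)[OF mo _ be less.prems] le unfolding T_def bi
          by (auto simp: std_bi_def std_mons_def)
        ultimately show ?thesis using pvs.span_mono by blast
      qed
      \<comment> \<open>The relation given by the minor is multiplied by the cofactor
        \<open>e\<close>. Solving for its leading term expresses \<open>curve_mon a\<close> by
        smaller monomials of the same bidegree.\<close>
      have "(\<Sum>b\<in>Poly_Mapping.keys ?g. smult (Poly_Mapping.lookup ?g b) (curve_mon (b + e))) =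
        (\<Sum>b\<in>Poly_Mapping.keys ?g. smult (Poly_Mapping.lookup ?g b) (curve_mon b)) * curve_mon e"
        by (simp add: sum_distrib_right)
      then have "(\<Sum>b\<in>Poly_Mapping.keys ?g. smult (Poly_Mapping.lookup ?g b) (curve_mon (b + e))) = 0"
        by (simp add: sum_ig_minor_curve[OF ijk])
      then have "smult (Poly_Mapping.lookup ?g ?m) (curve_mon a) =
        - (\<Sum>b\<in>Poly_Mapping.keys ?g - {?m}. smult (Poly_Mapping.lookup ?g b) (curve_mon (b + e)))"
        unfolding a by (subst (asm) sum.remove[OF _ antidiag_mon_in_keys[OF ijk]])
          (simp_all only: finite_keys eq_neg_iff_add_eq_0)
      also have "\<dots> \<in> pvs.span (T a)"
        by (intro pvs.span_neg pvs.span_sum pvs.span_scale IH)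
      finally have "smult (inverse (Poly_Mapping.lookup ?g ?m))
          (smult (Poly_Mapping.lookup ?g ?m) (curve_mon a)) \<in> pvs.span (T a)"
        by (rule pvs.span_scale)
      moreover have "Poly_Mapping.lookup ?g ?m \<noteq> 0"
        using antidiag_mon_in_keys[OF ijk] by (simp only: in_keys_iff not_False_eq_True)
      ultimately show ?thesis by simp
    qed
  qed
  then show ?thesis by (simp add: T_def)
qed

section \<open>Lower bound by orders of vanishing\<close>

lemma independent_distinct_orders:
  fixes v :: "nat \<Rightarrow> complex poly"
  assumes "finite B" "\<And>b. b \<in> B \<Longrightarrow> coeff (v b) b \<noteq> 0"
    "\<And>b j. b \<in> B \<Longrightarrow> j < b \<Longrightarrow> coeff (v b) j = 0"
  shows "inj_on v B \<and> pvs.independent (v ` B)"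
  using assms
proof (induction B rule: finite_linorder_min_induct)
  case (insert b A)
  \<comment> \<open>The induction inserts an element below all previous ones. The earlier
    polynomials have order larger than \<open>b\<close>, so their span has no coefficient at
    \<open>b\<close>, whereas \<open>v b\<close> has one.\<close>
  have sub: "pvs.subspace {p. coeff p b = 0}" by (simp add: pvs.subspace_def)
  have "v ` A \<subseteq> {p. coeff p b = 0}" using insert by auto
  then have "pvs.span (v ` A) \<subseteq> {p. coeff p b = 0}" by (rule pvs.span_minimal[OF _ sub])
  then have "v b \<notin> pvs.span (v ` A)" using insert.prems(1)[of b] by auto
  moreover from this have "v b \<notin> v ` A" using pvs.span_base by blast
  ultimately show ?case using insert by (auto simp: pvs.independent_insert)
qed (simp add: pvs.independent_empty)

lemma curve_mon_order:
  assumes "a \<in> mons d" "Poly_Mapping.lookup a 0 = 0"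
  shows "coeff (curve_mon a) (mon_deg a) \<noteq> 0" "\<And>j. j < mon_deg a \<Longrightarrow> coeff (curve_mon a) j = 0"
proof -
  \<comment> \<open>The quotient of \<open>curve_poly i\<close> by \<open>x\<close>, which exists
    for \<open>i \<ge> 1\<close> and then has a nonzero constant term.\<close>
  define q where "q i = (SOME q. curve_poly i = monom 1 1 * q)" for i
  have q: "curve_poly i = monom 1 1 * q i \<and> coeff (q i) 0 \<noteq> 0" if "i \<ge> 1" for i
  proof -
    have "monom 1 1 dvd curve_poly i"
      using curve_poly_coeff[OF that] by (simp add: monom_1_dvd_iff')
    then have "\<exists>q. curve_poly i = monom 1 1 * q" by (auto simp: dvd_def)
    then have eq: "curve_poly i = monom 1 1 * q i" unfolding q_def by (rule someI_ex)
    then have "coeff (curve_poly i) 1 = coeff (q i) 0" by (simp add: coeff_monom_mult)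
    then show ?thesis using eq curve_poly_coeff[OF that] by simp
  qed
  have "i \<ge> 1" if "i \<in> Poly_Mapping.keys a" for i
    using that assms(2) by (cases i) (auto simp: in_keys_iff)
  note q = q[OF this]
  have "curve_mon a = (\<Prod>i\<in>Poly_Mapping.keys a. (monom 1 1 * q i) ^ Poly_Mapping.lookup a i)"
    unfolding mon_eval_def using q by (intro prod.cong) auto
  also have "\<dots> = monom 1 1 ^ mon_deg a * mon_eval q a"
    by (simp add: power_mult_distrib prod.distrib power_sum mon_deg_def mon_eval_def)
  finally have eq: "curve_mon a = monom 1 (mon_deg a) * mon_eval q a"
    by (simp add: monom_power)
  have nz: "coeff (mon_eval q a) 0 \<noteq> 0"
    using q by (simp add: mon_eval_def poly_prod flip: poly_0_coeff_0)
  show "coeff (curve_mon a) (mon_deg a) \<noteq> 0" "\<And>j. j < mon_deg a \<Longrightarrow> coeff (curve_mon a) j = 0"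
    using nz unfolding eq by (simp_all add: coeff_monom_mult)
qed

text \<open>The weight \<open>w\<close> is spread as evenly as possible over \<open>b\<close>
  variables: with quotient \<open>q\<close> and remainder \<open>r\<close> of \<open>w\<close> by
  \<open>b\<close>, take \<open>r\<close> times the index \<open>q + 1\<close> and
  \<open>b - r\<close> times the index \<open>q\<close>. The bounds on \<open>w\<close> keep the
  indices that occur between 1 and \<open>d\<close>.\<close>

lemma exists_mon_deg_weight:
  assumes "b \<le> w" "w \<le> d * b"
  obtains a where "a \<in> mons d" "Poly_Mapping.lookup a 0 = 0" "mon_deg a = b" "mon_weight a = w"
proof (cases "b = 0")
  case True
  then show thesis using assms by (intro that[of 0]) auto
next
  case False
  define q r where "q = w div b" and "r = w mod b"
  have w: "w = b * q + r" "r < b" using False by (auto simp: q_def r_def)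
  have "q \<ge> 1" unfolding q_def using assms False by (simp add: Suc_le_eq div_greater_zero_iff)
  have "q \<le> d" unfolding q_def using assms False
    by (metis div_le_mono nonzero_mult_div_cancel_right)
  have "q + 1 \<le> d" if "r > 0"
  proof (rule ccontr)
    assume "\<not> q + 1 \<le> d"
    then have "q = d" using \<open>q \<le> d\<close> by simp
    then show False using w assms that by (simp add: mult.commute)
  qed
  then have "Poly_Mapping.single (q + 1) r + Poly_Mapping.single q (b - r) \<in> mons d"
    using \<open>q \<le> d\<close> by auto
  moreover have "(q + 1) * r + q * (b - r) = w"
  proof -
    obtain c where "b = r + c" using w(2) less_imp_add_positive by blast
    then show ?thesis using w(1) by (simp add: algebra_simps)
  qed
  ultimately show thesis using \<open>q \<ge> 1\<close> w(2)
    by (intro that[of "Poly_Mapping.single (q + 1) r + Poly_Mapping.single q (b - r)"])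
      (auto simp: lookup_add lookup_single)
qed

text \<open>No antidiagonal term contains the variable 0, so dividing or multiplying by it does not
  affect divisibility by such terms.\<close>

lemma single_0_std_bi:
  assumes "d \<ge> 3" "a \<in> std_bi d n w"
  shows "a + Poly_Mapping.single 0 k \<in> std_bi d (n + k) w"
proof -
  have "a + Poly_Mapping.single 0 k \<noteq> antidiag_mon i j l + e"
    if ijl: "i < j" "j < l" "l < d" for i j l e
  proof
    assume eq: "a + Poly_Mapping.single 0 k = antidiag_mon i j l + e"
    have "Poly_Mapping.lookup (antidiag_mon i j l) 0 = 0"
      using ijl by (auto simp: antidiag_mon_def lookup_add lookup_single when_def)
    then have "Poly_Mapping.lookup e 0 = Poly_Mapping.lookup a 0 + k"
      using arg_cong[OF eq, of "\<lambda>a. Poly_Mapping.lookup a 0"] by (simp add: lookup_add)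
    then have "e = (e - Poly_Mapping.single 0 k) + Poly_Mapping.single 0 k"
      by (intro poly_mapping_eqI) (simp add: lookup_add lookup_minus lookup_single when_def)
    then have "a = antidiag_mon i j l + (e - Poly_Mapping.single 0 k)"
      using eq by (metis add.assoc add_right_cancel)
    then show False using assms(2) ijl unfolding std_bi_def std_mons_def by blast
  qed
  then show ?thesis using assms by (auto simp: std_bi_def std_mons_def)
qed

text \<open>For \<open>w \<le> n\<close> a dimension count closes up: the restrictions span
  polynomials of \<open>card ?B\<close> distinct orders, but there are at most
  \<open>card ?B\<close> standard monomials. So none of them can be redundant and no two
  restrictions can coincide.\<close>

lemma curve_mon_std_independent:
  assumes "d \<ge> 3"
  shows "inj_on curve_mon (std_bi d n w) \<and> pvs.independent (curve_mon ` std_bi d n w)"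
proof -
  have main: "inj_on curve_mon (std_bi d n w) \<and> pvs.independent (curve_mon ` std_bi d n w)"
    if "w \<le> n" for n
  proof -
    let ?S = "std_bi d n w" and ?B = "{b. b \<le> w \<and> w \<le> d * b}"
    have "\<exists>v. v \<in> pvs.span (curve_mon ` ?S) \<and> coeff v b \<noteq> 0 \<and> (\<forall>j<b. coeff v j = 0)"
      if "b \<in> ?B" for b
    proof -
      obtain a where a: "a \<in> mons d" "Poly_Mapping.lookup a 0 = 0" "mon_deg a = b" "mon_weight a = w"
        using exists_mon_deg_weight \<open>b \<in> ?B\<close> by blast
      let ?a = "a + Poly_Mapping.single 0 (n - b)"
      have "mon_deg ?a = n" "mon_weight ?a = w" using a \<open>b \<in> ?B\<close> \<open>w \<le> n\<close> by auto
      then have "curve_mon ?a \<in> pvs.span (curve_mon ` {b \<in> ?S. revlex b ?a})"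
        using curve_mon_in_span_std[OF revlex_antidiagonal_order[of d], of ?a] a by simp
      then have "curve_mon ?a \<in> pvs.span (curve_mon ` ?S)"
        using pvs.span_mono[of "curve_mon ` {b \<in> ?S. revlex b ?a}" "curve_mon ` ?S"] by auto
      moreover have "curve_mon ?a = curve_mon a" by simp
      ultimately show ?thesis using curve_mon_order[OF a(1,2)] a(3) by auto
    qed
    then have "\<forall>b\<in>?B. \<exists>v. v \<in> pvs.span (curve_mon ` ?S) \<and> coeff v b \<noteq> 0 \<and> (\<forall>j<b. coeff v j = 0)"
      by blast
    from bchoice[OF this] obtain v where v: "\<And>b. b \<in> ?B \<Longrightarrow> v b \<in> pvs.span (curve_mon ` ?S)"
      "\<And>b. b \<in> ?B \<Longrightarrow> coeff (v b) b \<noteq> 0" "\<And>b j. b \<in> ?B \<Longrightarrow> j < b \<Longrightarrow> coeff (v b) j = 0"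
      by blast
    have finB: "finite ?B" by (rule finite_subset[of _ "{..w}"]) auto
    have indep: "inj_on v ?B" "pvs.independent (v ` ?B)"
      using independent_distinct_orders[OF finB v(2,3)] by auto
    \<comment> \<open>Exchange bound for any finite set that spans the polynomials
      \<open>v b\<close>. Applied to all restrictions it gives injectivity, and applied after
      dropping a redundant one it contradicts the upper bound on their number.\<close>
    have bound: "card ?B \<le> card T" if "finite T" "v ` ?B \<subseteq> pvs.span T" for T
      using pvs.independent_span_bound[OF that(1) indep(2) that(2)] card_image[OF indep(1)] by simp
    have S: "finite ?S" "card ?S \<le> card ?B"
      using finite_std_bi card_std_bi_le[OF assms] by auto
    have vS: "v ` ?B \<subseteq> pvs.span (curve_mon ` ?S)" using v(1) by auto
    have "card ?B \<le> card (curve_mon ` ?S)" by (rule bound) (use S vS in auto)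
    then have card: "card (curve_mon ` ?S) = card ?S" using S card_image_le[OF S(1), of curve_mon] by linarith
    have "pvs.independent (curve_mon ` ?S)"
    proof (rule ccontr)
      assume "\<not> pvs.independent (curve_mon ` ?S)"
      then obtain t where t: "t \<in> curve_mon ` ?S" "t \<in> pvs.span (curve_mon ` ?S - {t})"
        by (auto simp: pvs.dependent_def)
      then have "pvs.span (curve_mon ` ?S) = pvs.span (curve_mon ` ?S - {t})"
        using pvs.span_redundant[OF t(2)] by (simp add: insert_absorb)
      then have "card ?B \<le> card (curve_mon ` ?S - {t})" using S vS by (intro bound) auto
      also have "\<dots> < card (curve_mon ` ?S)" using t(1) S(1) by (intro psubset_card_mono) auto
      finally show False using card S(2) by simp
    qed
    then show ?thesis using eq_card_imp_inj_on[OF S(1) card] by blast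
  qed
  \<comment> \<open>An arbitrary degree is raised to at least \<open>w\<close> by a power of the
    variable 0. Its restriction is the constant 1, so the shift leaves all restrictions
    unchanged.\<close>
  let ?sh = "\<lambda>a. a + Poly_Mapping.single 0 w"
  have sub: "?sh ` std_bi d n w \<subseteq> std_bi d (n + w) w"
    using single_0_std_bi[OF assms] by blast
  have eq: "curve_mon (?sh a) = curve_mon a" for a by simp
  have M: "inj_on curve_mon (std_bi d (n + w) w)" "pvs.independent (curve_mon ` std_bi d (n + w) w)"
    using main[of "n + w"] by auto
  have "curve_mon ` std_bi d n w = curve_mon ` ?sh ` std_bi d n w"
    by (simp only: image_image eq)
  then have "pvs.independent (curve_mon ` std_bi d n w)"
    using pvs.independent_mono[OF M(2)] image_mono[OF sub, of curve_mon] by metis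
  moreover have "inj_on curve_mon (std_bi d n w)"
  proof (rule inj_onI)
    fix a b assume ab: "a \<in> std_bi d n w" "b \<in> std_bi d n w" "curve_mon a = curve_mon b"
    then have "?sh a = ?sh b" using inj_onD[OF M(1), of "?sh a" "?sh b"] sub eq by auto
    then show "a = b" by simp
  qed
  ultimately show ?thesis by blast
qed

section \<open>The vanishing ideal and its initial ideals\<close>

definition ig_gens :: "nat \<Rightarrow> cpoly set" where
  "ig_gens d = {f \<in> homogeneous_polys d. \<forall>\<mu> l. l \<noteq> 0 \<longrightarrow> vanishes_at f (proj_point d (ig_moment \<mu> l))}"

text \<open>A form that vanishes at the moment points cuts out a closed set containing them, hence
  vanishes on the closure. So the closure imposes no further conditions on forms.\<close>

lemma vanishing_ideal_ig_variety: "vanishing_ideal d (ig_variety d) = Idl\<^bsub>poly_ring d\<^esub> (ig_gens d)"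
proof -
  let ?X = "{proj_point d (ig_moment \<mu> l) | \<mu> l. l \<noteq> 0}"
  have X: "?X \<subseteq> proj_space d"
  proof
    fix P assume "P \<in> ?X"
    then obtain \<mu> l where "P = proj_point d (ig_moment \<mu> l)" by blast
    moreover have "\<exists>i\<le>d. ig_moment \<mu> l i \<noteq> 0" by (intro exI[of _ 0]) simp
    ultimately show "P \<in> proj_space d" unfolding proj_space_def by blast
  qed
  have "?X \<subseteq> ig_variety d" by (auto simp: ig_variety_def zariski_closure_def)
  moreover have "vanishes_at f P" if f: "f \<in> ig_gens d" and P: "P \<in> ig_variety d" for f P
  proof -
    have "{f} \<subseteq> homogeneous_polys d" "?X \<subseteq> proj_zero_set d {f}"
      using f X unfolding ig_gens_def proj_zero_set_def by blast+
    then have "P \<in> proj_zero_set d {f}" using P unfolding ig_variety_def zariski_closure_def by blast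
    then show ?thesis by (simp add: proj_zero_set_def)
  qed
  ultimately have "{f \<in> homogeneous_polys d. \<forall>P\<in>ig_variety d. vanishes_at f P} = ig_gens d"
    unfolding ig_gens_def by blast
  then show ?thesis by (simp add: vanishing_ideal_def)
qed

lemma poly_ring_ring: "ring (poly_ring d)"
  using poly_ring_cring by (rule cring.axioms)

lemma ig_gens_carrier: "ig_gens d \<subseteq> carrier (poly_ring d)"
  by (auto simp: ig_gens_def homogeneous_polys_def)

abbreviation ig_ideal :: "nat \<Rightarrow> cpoly set" where
  "ig_ideal d \<equiv> Idl\<^bsub>poly_ring d\<^esub> (ig_gens d)"

lemma ig_ideal_ideal: "ideal (ig_ideal d) (poly_ring d)"
  by (rule ring.genideal_ideal[OF poly_ring_ring ig_gens_carrier])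

lemma uminus_poly_ring:
  assumes "p \<in> carrier (poly_ring d)"
  shows "a_inv (poly_ring d) p = - p"
proof -
  interpret R: ring "poly_ring d" by (rule poly_ring_ring)
  show ?thesis using assms by (intro R.minus_equality) auto
qed

section \<open>Membership in the ideal, bidegree by bidegree\<close>

definition cone_ideal :: "nat \<Rightarrow> cpoly set" where
  "cone_ideal d = {f \<in> carrier (poly_ring d). \<forall>c s x. c \<noteq> 0 \<longrightarrow> s \<noteq> 0 \<longrightarrow>
     eval_poly (\<lambda>i. c * s ^ i * poly (curve_poly i) x) f = 0}"

lemma cone_ideal_ideal: "ideal (cone_ideal d) (poly_ring d)"
proof (rule idealI[OF poly_ring_ring])
  interpret R: ring "poly_ring d" by (rule poly_ring_ring)
  show "subgroup (cone_ideal d) (add_monoid (poly_ring d))"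
  proof (rule R.add.subgroupI)
    fix f assume f: "f \<in> cone_ideal d"
    then have "a_inv (poly_ring d) f = - f"
      by (intro uminus_poly_ring) (simp add: cone_ideal_def)
    then show "a_inv (poly_ring d) f \<in> cone_ideal d"
      using f by (simp add: cone_ideal_def)
  next
    have "0 \<in> cone_ideal d" by (simp add: cone_ideal_def)
    then show "cone_ideal d \<noteq> {}" by blast
  next
    fix f g assume "f \<in> cone_ideal d" "g \<in> cone_ideal d"
    then show "f \<oplus>\<^bsub>poly_ring d\<^esub> g \<in> cone_ideal d"
      by (simp add: cone_ideal_def keys_add_mons)
  qed (auto simp: cone_ideal_def)
qed (auto simp: cone_ideal_def intro: subsetD[OF keys_mult_mons])

lemma scaled_curve_0: "s ^ i * poly (curve_poly i) 0 = poly (curve_poly i) 0"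
proof (cases i)
  case (Suc j)
  then show ?thesis using curve_poly_coeff[of i] by (simp add: poly_0_coeff_0)
qed simp

text \<open>Elements of the generated ideal need not be homogeneous, so vanishing is tested on the
  torus translates of the curve in affine space. The polynomials passing this pointwise test form an
  ideal, and only the generators remain to be checked.\<close>

lemma ig_ideal_subset_cone: "ig_ideal d \<subseteq> cone_ideal d"
proof (rule ring.genideal_minimal[OF poly_ring_ring cone_ideal_ideal], rule)
  fix f assume f: "f \<in> ig_gens d"
  have "eval_poly (\<lambda>i. c * s ^ i * poly (curve_poly i) x) f = 0" if cs: "c \<noteq> 0" "s \<noteq> 0" for c s x
  proof -
    obtain \<mu> l where \<mu>l: "l \<noteq> 0" "\<And>i. ig_moment \<mu> l i = s ^ i * poly (curve_poly i) x"
    proof (cases "x = 0")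
      case True
      then show ?thesis using that[of 1 0] by (simp add: ig_moment_0 scaled_curve_0)
    next
      case False
      then show ?thesis
        using that[of "s * x\<^sup>2" "s * x"] ig_moment_curve cs by simp
    qed
    have "(\<lambda>i. if i \<le> d then c * ig_moment \<mu> l i else 0) \<in> proj_point d (ig_moment \<mu> l)"
      using cs unfolding proj_point_def by blast
    then have "eval_poly (\<lambda>i. if i \<le> d then c * ig_moment \<mu> l i else 0) f = 0"
      using f \<mu>l(1) unfolding ig_gens_def vanishes_at_def by blast
    moreover have "eval_poly (\<lambda>i. c * s ^ i * poly (curve_poly i) x) f
        = eval_poly (\<lambda>i. if i \<le> d then c * ig_moment \<mu> l i else 0) f"
      by (rule eval_poly_cong[of _ d])
        (use f in \<open>auto simp: ig_gens_def homogeneous_polys_def \<mu>l mult.assoc\<close>)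
    ultimately show ?thesis by simp
  qed
  moreover have "f \<in> carrier (poly_ring d)" using f ig_gens_carrier by blast
  ultimately show "f \<in> cone_ideal d" by (simp add: cone_ideal_def)
qed

text \<open>This is the restriction to the curve of the component of bidegree
  \<open>(n, w)\<close>.\<close>

definition bi_curve_sum :: "nat \<Rightarrow> nat \<Rightarrow> cpoly \<Rightarrow> complex poly" where
  "bi_curve_sum n w f = (\<Sum>a | a \<in> Poly_Mapping.keys f \<and> mon_deg a = n \<and> mon_weight a = w.
     smult (Poly_Mapping.lookup f a) (curve_mon a))"

lemma eval_poly_scaled:
  fixes p :: "nat \<Rightarrow> complex"
  shows "eval_poly (\<lambda>i. c * s ^ i * p i) f = (\<Sum>a\<in>Poly_Mapping.keys f.
    Poly_Mapping.lookup f a * (c ^ mon_deg a * s ^ mon_weight a * mon_eval p a))"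
  by (simp add: eval_poly_alt mon_eval_scale)

text \<open>Choosing \<open>c = s ^ N\<close> with \<open>N\<close> larger than all weights separates the bidegrees by
  the powers of the single variable \<open>s\<close>.\<close>

lemma cone_ideal_bi_curve_sum:
  assumes "f \<in> cone_ideal d"
  shows "bi_curve_sum n w f = 0"
proof -
  define N where "N = Suc (w + (\<Sum>a\<in>Poly_Mapping.keys f. mon_weight a))"
  have N: "mon_weight a < N" if "a \<in> Poly_Mapping.keys f" for a
    using member_le_sum[OF that, of mon_weight] by (simp add: N_def)
  have "poly (bi_curve_sum n w f) x = 0" for x
  proof -
    let ?p = "\<lambda>i. poly (curve_poly i) x"
    let ?c = "\<lambda>a. Poly_Mapping.lookup f a * mon_eval ?p a"
    define Q where "Q = (\<Sum>a\<in>Poly_Mapping.keys f. monom (?c a) (N * mon_deg a + mon_weight a))"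
    have "poly Q s = 0" if "s \<noteq> 0" for s
    proof -
      have "poly Q s = eval_poly (\<lambda>i. s ^ N * s ^ i * ?p i) f"
        unfolding eval_poly_scaled
        by (simp add: Q_def poly_sum poly_monom power_add power_mult mult_ac)
      also have "\<dots> = 0" using assms that by (simp add: cone_ideal_def)
      finally show ?thesis .
    qed
    \<comment> \<open>Vanishing of \<open>Q\<close> is known only for \<open>s \<noteq> 0\<close>.
      The extra factor covers \<open>s = 0\<close> and is cancelled afterwards.\<close>
    then have "poly (monom 1 1 * Q) s = 0" for s by (cases "s = 0") (auto simp: poly_monom)
    then have "monom 1 1 * Q = 0" by (simp add: poly_eq_poly_eq_iff[symmetric] fun_eq_iff)
    then have "Q = 0" by simp
    \<comment> \<open>Since \<open>w\<close> is also below \<open>N\<close>, quotient and remainder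
      by \<open>N\<close> recover the degree and the weight.\<close>
    have *: "N * mon_deg a + mon_weight a = N * n + w \<longleftrightarrow> mon_deg a = n \<and> mon_weight a = w"
      if "a \<in> Poly_Mapping.keys f" for a
    proof
      assume eq: "N * mon_deg a + mon_weight a = N * n + w"
      have "mon_weight a < N" "w < N" using N[OF that] by (auto simp: N_def)
      then show "mon_deg a = n \<and> mon_weight a = w"
        using arg_cong[OF eq, of "\<lambda>z. z div N"] arg_cong[OF eq, of "\<lambda>z. z mod N"] by simp
    qed simp
    have "poly (bi_curve_sum n w f) x
        = (\<Sum>a | a \<in> Poly_Mapping.keys f \<and> mon_deg a = n \<and> mon_weight a = w. ?c a)"
      by (simp add: bi_curve_sum_def poly_sum poly_mon_eval)
    also have "\<dots> = (\<Sum>a\<in>Poly_Mapping.keys f. if mon_deg a = n \<and> mon_weight a = w then ?c a else 0)"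
      by (rule sum.inter_filter) simp
    also have "\<dots> = coeff Q (N * n + w)"
      unfolding Q_def coeff_sum coeff_monom using * by (intro sum.cong) auto
    finally show ?thesis using \<open>Q = 0\<close> by simp
  qed
  then show ?thesis by (simp add: poly_eq_poly_eq_iff[symmetric] fun_eq_iff)
qed

text \<open>This is the converse for forms. Grouping by weight writes the value of \<open>f\<close>
  at a translate of the curve as the sum of \<open>c^n * s^w\<close> times the value of
  \<open>bi_curve_sum n w f\<close>, and every moment vector lies on such a translate.\<close>

lemma ig_idealI:
  assumes f: "f \<in> carrier (poly_ring d)" "homogeneous n f" and "\<And>w. bi_curve_sum n w f = 0"
  shows "f \<in> ig_ideal d"
proof -
  have scaled: "eval_poly (\<lambda>i. c * (s ^ i * poly (curve_poly i) x)) f = 0" for c s x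
  proof -
    let ?p = "\<lambda>i. poly (curve_poly i) x"
    let ?t = "\<lambda>a. Poly_Mapping.lookup f a * (c ^ mon_deg a * s ^ mon_weight a * mon_eval ?p a)"
    have "eval_poly (\<lambda>i. c * (s ^ i * ?p i)) f = (\<Sum>a\<in>Poly_Mapping.keys f. ?t a)"
      using eval_poly_scaled[of c s ?p f] by (simp add: mult.assoc)
    also have "\<dots> = (\<Sum>w\<in>mon_weight ` Poly_Mapping.keys f.
        \<Sum>a | a \<in> Poly_Mapping.keys f \<and> mon_weight a = w. ?t a)"
      by (rule sum.image_gen) simp
    also have "\<dots> = (\<Sum>w\<in>mon_weight ` Poly_Mapping.keys f. 0)"
    proof (rule sum.cong[OF refl])
      fix w
      have set: "{a. a \<in> Poly_Mapping.keys f \<and> mon_weight a = w} =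
          {a. a \<in> Poly_Mapping.keys f \<and> mon_deg a = n \<and> mon_weight a = w}"
        using f(2) by (auto simp: homogeneous_def)
      have "(\<Sum>a | a \<in> Poly_Mapping.keys f \<and> mon_weight a = w. ?t a)
          = c ^ n * s ^ w * poly (bi_curve_sum n w f) x"
        unfolding set bi_curve_sum_def poly_sum sum_distrib_left
        by (intro sum.cong) (auto simp: poly_mon_eval)
      then show "(\<Sum>a | a \<in> Poly_Mapping.keys f \<and> mon_weight a = w. ?t a) = 0"
        using assms(3) by simp
    qed
    finally show ?thesis by simp
  qed
  have "vanishes_at f (proj_point d (ig_moment \<mu> l))" if "l \<noteq> 0" for \<mu> l
    unfolding vanishes_at_def
  proof
    fix y assume "y \<in> proj_point d (ig_moment \<mu> l)"
    then obtain c where y: "y = (\<lambda>i. if i \<le> d then c * ig_moment \<mu> l i else 0)"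
      unfolding proj_point_def by blast
    obtain s x where sx: "\<And>i. ig_moment \<mu> l i = s ^ i * poly (curve_poly i) x"
    proof (cases "\<mu> = 0")
      case True
      then show ?thesis using that[of 1 0] by (simp add: ig_moment_0)
    next
      case False
      \<comment> \<open>These are the solutions \<open>s = \<mu>^2 / l\<close> and
        \<open>x = l / \<mu>\<close> of the equations \<open>\<mu> = s * x\<close> and
        \<open>l = s * x^2\<close>.\<close>
      have "(\<mu>\<^sup>2 / l) * (l / \<mu>) = \<mu>" "(\<mu>\<^sup>2 / l) * (l / \<mu>)\<^sup>2 = l"
        using False \<open>l \<noteq> 0\<close> by (simp_all add: field_simps power2_eq_square)
      then show ?thesis
        using that[of "\<mu>\<^sup>2 / l" "l / \<mu>"] ig_moment_curve[of "l / \<mu>" "\<mu>\<^sup>2 / l"] False \<open>l \<noteq> 0\<close>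
        by simp
    qed
    have "eval_poly y f = eval_poly (\<lambda>i. c * (s ^ i * poly (curve_poly i) x)) f"
      by (rule eval_poly_cong[of _ d]) (use f in \<open>auto simp: y sx\<close>)
    then show "eval_poly y f = 0" by (simp add: scaled)
  qed
  then have "f \<in> ig_gens d" using f by (auto simp: ig_gens_def homogeneous_polys_def)
  then show ?thesis using ring.genideal_self[OF poly_ring_ring ig_gens_carrier] by blast
qed

lemma ig_ideal_bi_curve_sum: "f \<in> ig_ideal d \<Longrightarrow> bi_curve_sum n w f = 0"
  using ig_ideal_subset_cone cone_ideal_bi_curve_sum by blast

text \<open>A minor is bihomogeneous, so only one of its restrictions is not an empty sum, and that
  one is zero because the rows are dependent on the curve.\<close>

lemma ig_minors_subset: "ig_minors d \<subseteq> ig_ideal d"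
proof
  fix f assume "f \<in> ig_minors d"
  then obtain i j k where ijk: "i < j" "j < k" "k < d" and f: "f = ig_minor d i j k"
    by (auto simp: ig_minors_def)
  let ?m = "antidiag_mon i j k"
  have keys: "b \<in> mons d \<and> mon_deg b = mon_deg ?m \<and> mon_weight b = mon_weight ?m"
    if "b \<in> Poly_Mapping.keys f" for b
    using that keys_ig_minor[OF ijk] antidiag_mon_mons[OF ijk] by (auto simp: f lower_mons_def)
  show "f \<in> ig_ideal d"
  proof (rule ig_idealI)
    show "homogeneous (mon_deg ?m) f" using keys by (simp add: homogeneous_def)
    show "bi_curve_sum (mon_deg ?m) w f = 0" for w
    proof (cases "w = mon_weight ?m")
      case True
      then have "{a. a \<in> Poly_Mapping.keys f \<and> mon_deg a = mon_deg ?m \<and> mon_weight a = w} =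
        Poly_Mapping.keys f" using keys by auto
      then show ?thesis unfolding bi_curve_sum_def f by (simp add: sum_ig_minor_curve[OF ijk])
    next
      case False
      then have "{a. a \<in> Poly_Mapping.keys f \<and> mon_deg a = mon_deg ?m \<and> mon_weight a = w} = {}"
        using keys by auto
      then show ?thesis unfolding bi_curve_sum_def by (simp only: sum.empty)
    qed
  qed (use keys in auto)
qed

text \<open>Suppose \<open>a\<close> is standard. The component of \<open>f\<close> in the bidegree
  of \<open>a\<close> restricts to zero, and each of its other terms is smaller than
  \<open>a\<close>, hence rewrites into standard monomials smaller than \<open>a\<close>. The
  restriction of \<open>a\<close> would then be a combination of those of other standard monomials,
  against independence. The order bound in \<open>curve_mon_in_span_std\<close> is what keeps
  \<open>a\<close> itself out of the combination.\<close>

lemma initial_mon_not_std: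
  assumes "d \<ge> 3" "antidiagonal_order d leq" "f \<in> ig_ideal d" "is_initial_mon leq f a"
  shows "a \<notin> std_mons d"
proof
  assume "a \<in> std_mons d"
  let ?n = "mon_deg a" and ?w = "mon_weight a"
  let ?S = "std_bi d ?n ?w" and ?K = "{b. b \<in> Poly_Mapping.keys f \<and> mon_deg b = mon_deg a \<and> mon_weight b = mon_weight a}"
  have mo: "monomial_order d leq" using assms(2) by (simp add: antidiagonal_order_def)
  have aS: "a \<in> ?S" using \<open>a \<in> std_mons d\<close> by (simp add: std_bi_def)
  have inj: "inj_on curve_mon ?S" and ind: "pvs.independent (curve_mon ` ?S)"
    using curve_mon_std_independent[OF assms(1)] by blast+
  have aK: "a \<in> ?K" "finite ?K" using assms(4) by (auto simp: is_initial_mon_def)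
  have fc: "Poly_Mapping.keys f \<subseteq> mons d"
    using ideal.Icarr[OF ig_ideal_ideal assms(3)] by simp
  let ?T = "curve_mon ` ?S - {curve_mon a}"
  have "curve_mon b \<in> pvs.span ?T" if b: "b \<in> ?K - {a}" for b
  proof -
    have bm: "b \<in> mons d" "leq b a" "a \<in> mons d"
      using b fc assms(4) by (auto simp: is_initial_mon_def)
    have "curve_mon b \<in> pvs.span (curve_mon ` {c \<in> ?S. leq c b})"
      using curve_mon_in_span_std[OF assms(2) bm(1)] b by simp
    moreover have "curve_mon ` {c \<in> ?S. leq c b} \<subseteq> ?T"
    proof
      fix q assume "q \<in> curve_mon ` {c \<in> ?S. leq c b}"
      then obtain c where c: "q = curve_mon c" "c \<in> ?S" "leq c b" by blast
      then have "c \<noteq> a" using monomial_orderD(3)[OF mo bm(1,3)] bm(2) b by auto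
      then show "q \<in> ?T" using c inj_onD[OF inj, of c a] aS by auto
    qed
    ultimately show ?thesis using pvs.span_mono by blast
  qed
  then have "- (\<Sum>b\<in>?K - {a}. smult (Poly_Mapping.lookup f b) (curve_mon b)) \<in> pvs.span ?T"
    by (intro pvs.span_neg pvs.span_sum pvs.span_scale)
  moreover have "smult (Poly_Mapping.lookup f a) (curve_mon a) =
      - (\<Sum>b\<in>?K - {a}. smult (Poly_Mapping.lookup f b) (curve_mon b))"
    using ig_ideal_bi_curve_sum[OF assms(3), of ?n ?w] unfolding bi_curve_sum_def
    by (subst (asm) sum.remove[OF aK(2,1)]) (simp only: eq_neg_iff_add_eq_0)
  ultimately have "smult (Poly_Mapping.lookup f a) (curve_mon a) \<in> pvs.span ?T" by simp
  then have "smult (inverse (Poly_Mapping.lookup f a)) (smult (Poly_Mapping.lookup f a) (curve_mon a))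
      \<in> pvs.span ?T" by (rule pvs.span_scale)
  then have "curve_mon a \<in> pvs.span ?T" using aK(1) by (simp add: in_keys_iff)
  then have "pvs.dependent (curve_mon ` ?S)" using aS unfolding pvs.dependent_def by blast
  then show False using ind by simp
qed

lemma ig_groebner:
  assumes "d \<ge> 3" "antidiagonal_order d leq"
  shows "groebner_basis d leq (ig_minors d) (ig_ideal d)"
proof -
  interpret R: ring "poly_ring d" by (rule poly_ring_ring)
  have "ig_minors d \<subseteq> (\<lambda>(i, j, k). ig_minor d i j k) ` ({..<d} \<times> {..<d} \<times> {..<d})"
  proof
    fix f assume "f \<in> ig_minors d"
    then obtain i j k where "i < j" "j < k" "k < d" "f = ig_minor d i j k"
      by (auto simp: ig_minors_def)
    then show "f \<in> (\<lambda>(i, j, k). ig_minor d i j k) ` ({..<d} \<times> {..<d} \<times> {..<d})"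
      by (intro image_eqI[of _ _ "(i, j, k)"]) auto
  qed
  then have fin: "finite (ig_minors d)" by (rule finite_subset) simp
  let ?A = "\<lambda>F. {mon_poly a | a. \<exists>f\<in>F. is_initial_mon leq f a}"
  have car: "?A F \<subseteq> carrier (poly_ring d)" if "F \<subseteq> ig_ideal d" for F
  proof
    fix p assume "p \<in> ?A F"
    then obtain a f where p: "p = mon_poly a" "f \<in> F" "is_initial_mon leq f a" by blast
    then have "f \<in> carrier (poly_ring d)" using that ideal.Icarr[OF ig_ideal_ideal] by blast
    then show "p \<in> carrier (poly_ring d)" using p by (auto simp: mon_poly_def is_initial_mon_def)
  qed
  note carG = car[OF ig_minors_subset] and carI = car[OF order.refl]
  have idG: "ideal (Idl\<^bsub>poly_ring d\<^esub> (?A (ig_minors d))) (poly_ring d)"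
    by (rule R.genideal_ideal[OF carG])
  have idI: "ideal (Idl\<^bsub>poly_ring d\<^esub> (?A (ig_ideal d))) (poly_ring d)"
    by (rule R.genideal_ideal[OF carI])
  have "Idl\<^bsub>poly_ring d\<^esub> (?A (ig_minors d)) \<subseteq> Idl\<^bsub>poly_ring d\<^esub> (?A (ig_ideal d))"
    using R.genideal_self[OF carI] ig_minors_subset by (intro R.genideal_minimal[OF idI]) blast
  moreover have "Idl\<^bsub>poly_ring d\<^esub> (?A (ig_ideal d)) \<subseteq> Idl\<^bsub>poly_ring d\<^esub> (?A (ig_minors d))"
  proof (rule R.genideal_minimal[OF idG], rule)
    fix p assume p: "p \<in> ?A (ig_ideal d)"
    then obtain a f where a: "p = mon_poly a" "f \<in> ig_ideal d" "is_initial_mon leq f a" by blast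
    have "p \<in> carrier (poly_ring d)" using carI p by blast
    then have "a \<in> mons d" by (simp add: a(1) mon_poly_def)
    have "a \<notin> std_mons d" using initial_mon_not_std[OF assms a(2,3)] .
    with \<open>a \<in> mons d\<close> obtain i j k e where ijk: "i < j" "j < k" "k < d" and eq: "a = antidiag_mon i j k + e"
      by (auto simp: std_mons_def)
    have "is_initial_mon leq (ig_minor d i j k) (antidiag_mon i j k)"
      using antidiagonal_order_initial[OF assms(2) ijk] .
    then have "mon_poly (antidiag_mon i j k) \<in> ?A (ig_minors d)"
      using ijk unfolding ig_minors_def by blast
    then have "mon_poly (antidiag_mon i j k) \<in> Idl\<^bsub>poly_ring d\<^esub> (?A (ig_minors d))"
      using R.genideal_self[OF carG] by blast
    moreover have "mon_poly e \<in> carrier (poly_ring d)"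
      using \<open>a \<in> mons d\<close> by (simp add: eq mon_poly_def)
    ultimately have "mon_poly e \<otimes>\<^bsub>poly_ring d\<^esub> mon_poly (antidiag_mon i j k)
        \<in> Idl\<^bsub>poly_ring d\<^esub> (?A (ig_minors d))"
      by (rule ideal.I_l_closed[OF idG])
    then show "p \<in> Idl\<^bsub>poly_ring d\<^esub> (?A (ig_minors d))"
      by (simp add: a(1) eq mon_poly_def mult_single add.commute)
  qed
  ultimately show ?thesis
    using ig_ideal_ideal fin ig_minors_subset
    unfolding groebner_basis_def initial_ideal_def by blast
qed

section \<open>The Hilbert series\<close>

lemma bi_curve_sum_superset:
  assumes "finite T" "Poly_Mapping.keys f \<subseteq> T" "\<And>a. a \<in> T \<Longrightarrow> mon_deg a = n \<and> mon_weight a = w"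
  shows "bi_curve_sum n w f = (\<Sum>a\<in>T. smult (Poly_Mapping.lookup f a) (curve_mon a))"
  unfolding bi_curve_sum_def using assms
  by (intro sum.mono_neutral_left) (auto simp: in_keys_iff)

lemma bi_curve_sum_eq_0:
  assumes "\<And>a. a \<in> Poly_Mapping.keys f \<Longrightarrow> mon_weight a \<noteq> w"
  shows "bi_curve_sum n w f = 0"
  unfolding bi_curve_sum_def using assms by (intro sum.neutral) auto

definition std_deg :: "nat \<Rightarrow> nat \<Rightarrow> mon set" where
  "std_deg d n = {a \<in> std_mons d. mon_deg a = n}"

lemma finite_std_deg: "finite (std_deg d n)"
  by (rule finite_subset[OF _ finite_mons_deg[of d n]]) (auto simp: std_deg_def std_mons_def)

lemma std_deg_mons: "std_deg d n \<subseteq> mons d"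
  by (auto simp: std_deg_def std_mons_def)

text \<open>The coefficients that express the restriction of \<open>a\<close> are lifted to a
  polynomial \<open>g\<close> in standard monomials of the same bidegree. The difference is
  bihomogeneous and restricts to zero, so it lies in the ideal. Injectivity of the restriction lets
  the coefficients be indexed by monomials instead of polynomials.\<close>

lemma std_reduction_mon:
  assumes "d \<ge> 3" "a \<in> mons d"
  obtains g where "Poly_Mapping.keys g \<subseteq> std_deg d (mon_deg a)"
    "Poly_Mapping.single a 1 - g \<in> ig_ideal d"
proof -
  let ?n = "mon_deg a" and ?w = "mon_weight a"
  let ?S = "std_bi d ?n ?w"
  have "curve_mon a \<in> pvs.span (curve_mon ` {b \<in> ?S. revlex b a})"
    using curve_mon_in_span_std[OF revlex_antidiagonal_order assms(2)] .
  then have "curve_mon a \<in> pvs.span (curve_mon ` ?S)"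
    using pvs.span_mono[of "curve_mon ` {b \<in> ?S. revlex b a}" "curve_mon ` ?S"] by auto
  then obtain u where "curve_mon a = (\<Sum>q\<in>curve_mon ` ?S. smult (u q) q)"
    using pvs.span_finite[OF finite_imageI[OF finite_std_bi]] by auto
  then have u: "curve_mon a = (\<Sum>b\<in>?S. smult (u (curve_mon b)) (curve_mon b))"
    using curve_mon_std_independent[OF assms(1)] by (simp add: sum.reindex)
  define g where "g = (\<Sum>b\<in>?S. Poly_Mapping.single b (u (curve_mon b)))"
  have look: "Poly_Mapping.lookup g b = (if b \<in> ?S then u (curve_mon b) else 0)" for b
    by (simp add: g_def lookup_sum lookup_single when_def finite_std_bi)
  have keys: "Poly_Mapping.keys g \<subseteq> ?S" by (auto simp: in_keys_iff look split: if_splits)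
  let ?f = "Poly_Mapping.single a 1 - g"
  let ?T = "insert a ?S"
  have keysf: "Poly_Mapping.keys ?f \<subseteq> ?T"
    using keys keys_single_subset[of a 1] by (intro keys_minus_subset) auto
  have T: "mon_deg b = ?n \<and> mon_weight b = ?w \<and> b \<in> mons d" if "b \<in> ?T" for b
    using that assms(2) by (auto simp: std_bi_def std_mons_def)
  have "?f \<in> ig_ideal d"
  proof (rule ig_idealI)
    show "?f \<in> carrier (poly_ring d)" unfolding carrier_poly_ring using keysf T by blast
    show "homogeneous ?n ?f" unfolding homogeneous_def using keysf T by blast
    show "bi_curve_sum ?n w ?f = 0" for w
    proof (cases "w = ?w")
      case True
      have "bi_curve_sum ?n ?w ?f = (\<Sum>b\<in>?T. smult (Poly_Mapping.lookup ?f b) (curve_mon b))"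
        using T by (intro bi_curve_sum_superset[OF finite.insertI[OF finite_std_bi] keysf]) blast
      also have "\<dots> = (\<Sum>b\<in>?T. if b = a then curve_mon b else 0)
          - (\<Sum>b\<in>?T. smult (Poly_Mapping.lookup g b) (curve_mon b))"
        unfolding sum_subtractf[symmetric]
        by (intro sum.cong[OF refl]) (simp add: lookup_minus lookup_single when_def smult_diff_left)
      also have "(\<Sum>b\<in>?T. smult (Poly_Mapping.lookup g b) (curve_mon b))
          = (\<Sum>b\<in>?S. smult (Poly_Mapping.lookup g b) (curve_mon b))"
        using finite_std_bi by (intro sum.mono_neutral_right) (auto simp: look)
      also have "(\<Sum>b\<in>?T. if b = a then curve_mon b else 0) = curve_mon a"
        using finite_std_bi by simp
      finally show ?thesis using True u by (simp add: look)
    next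
      case False
      then show ?thesis using keysf T by (intro bi_curve_sum_eq_0) blast
    qed
  qed
  moreover have "Poly_Mapping.keys g \<subseteq> std_deg d ?n"
    using keys by (auto simp: std_bi_def std_deg_def)
  ultimately show thesis using that by blast
qed

lemma ig_ideal_add: "p \<in> ig_ideal d \<Longrightarrow> q \<in> ig_ideal d \<Longrightarrow> p + q \<in> ig_ideal d"
  using additive_subgroup.a_closed[OF ideal.axioms(1)[OF ig_ideal_ideal[of d]]] by simp

lemma ig_ideal_0: "0 \<in> ig_ideal d"
  using additive_subgroup.zero_closed[OF ideal.axioms(1)[OF ig_ideal_ideal[of d]]] by simp

lemma ig_ideal_const_mult: "p \<in> ig_ideal d \<Longrightarrow> Poly_Mapping.single 0 c * p \<in> ig_ideal d"
  using ideal.I_l_closed[OF ig_ideal_ideal[of d], of p "Poly_Mapping.single 0 c"] by simp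

lemma const_mult_lookup:
  "Poly_Mapping.lookup (Poly_Mapping.single 0 c * p :: cpoly) a = c * Poly_Mapping.lookup p a"
  by (simp add: mult_map_scale_conv_mult[symmetric] Poly_Mapping.map.rep_eq when_def)

lemma const_mult_keys:
  "Poly_Mapping.keys (Poly_Mapping.single 0 c * p :: cpoly) \<subseteq> Poly_Mapping.keys p"
  by (auto simp: in_keys_iff const_mult_lookup)

lemma std_reduction:
  assumes "d \<ge> 3" "p \<in> carrier (poly_ring d)" "homogeneous n p"
  obtains g where "Poly_Mapping.keys g \<subseteq> std_deg d n" "p - g \<in> ig_ideal d"
proof -
  have "\<exists>g. Poly_Mapping.keys g \<subseteq> std_deg d n \<and>
      (\<Sum>a\<in>A. Poly_Mapping.single a (c a)) - g \<in> ig_ideal d"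
    if "finite A" "A \<subseteq> {a \<in> mons d. mon_deg a = n}" for A c
    using that
  proof (induction A rule: finite_induct)
    case empty
    then show ?case by (intro exI[of _ 0]) (simp add: ig_ideal_0)
  next
    case (insert a A)
    then obtain g where g: "Poly_Mapping.keys g \<subseteq> std_deg d n"
      "(\<Sum>a\<in>A. Poly_Mapping.single a (c a)) - g \<in> ig_ideal d" by auto
    obtain h where h: "Poly_Mapping.keys h \<subseteq> std_deg d n" "Poly_Mapping.single a 1 - h \<in> ig_ideal d"
      using std_reduction_mon[OF assms(1), of a] insert.prems by auto
    let ?g = "g + Poly_Mapping.single 0 (c a) * h"
    have "Poly_Mapping.keys ?g \<subseteq> std_deg d n"
      using g(1) h(1) const_mult_keys[of "c a" h] by (intro keys_plus_subset) auto
    moreover have "(\<Sum>a\<in>insert a A. Poly_Mapping.single a (c a)) - ?g =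
      ((\<Sum>a\<in>A. Poly_Mapping.single a (c a)) - g)
        + Poly_Mapping.single 0 (c a) * (Poly_Mapping.single a 1 - h)"
      using insert.hyps by (simp add: right_diff_distrib mult_single)
    ultimately show ?case
      using ig_ideal_add[OF g(2) ig_ideal_const_mult[OF h(2), of "c a"]] by metis
  qed
  from this[of "Poly_Mapping.keys p" "Poly_Mapping.lookup p"]
  show thesis using that assms(2,3) cpoly_sum_single[of p] by (auto simp: homogeneous_def)
qed

text \<open>In each bidegree the restriction is a vanishing combination of independent polynomials.
  Since distinct standard monomials have distinct restrictions, \<open>inv_into\<close> reads off
  each coefficient separately.\<close>

lemma std_in_ideal_eq_0:
  assumes "d \<ge> 3" "f \<in> ig_ideal d" "Poly_Mapping.keys f \<subseteq> std_mons d"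
  shows "f = 0"
proof -
  have "Poly_Mapping.lookup f a = 0" if "a \<in> std_mons d" for a
  proof -
    let ?S = "std_bi d (mon_deg a) (mon_weight a)"
    have inj: "inj_on curve_mon ?S" and ind: "pvs.independent (curve_mon ` ?S)"
      using curve_mon_std_independent[OF assms(1)] by blast+
    let ?u = "\<lambda>q. Poly_Mapping.lookup f (inv_into ?S curve_mon q)"
    have "(\<Sum>q\<in>curve_mon ` ?S. smult (?u q) q) =
        (\<Sum>b\<in>?S. smult (Poly_Mapping.lookup f b) (curve_mon b))"
      using inj by (simp add: sum.reindex)
    also have "\<dots> = bi_curve_sum (mon_deg a) (mon_weight a) f"
      unfolding bi_curve_sum_def using assms(3) finite_std_bi
      by (intro sum.mono_neutral_right) (auto simp: std_bi_def in_keys_iff)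
    also have "\<dots> = 0" by (rule ig_ideal_bi_curve_sum[OF assms(2)])
    finally have "?u (curve_mon a) = 0"
      using that
      by (intro pvs.independentD[OF ind finite_imageI[OF finite_std_bi] order.refl]) (auto simp: std_bi_def)
    then show ?thesis using that inj by (simp add: std_bi_def)
  qed
  then show ?thesis using assms(3) by (intro poly_mapping_eqI) (metis in_keys_iff lookup_zero subsetD)
qed

section \<open>Dimensions of the graded pieces\<close>

definition const_polys :: "cpoly set" where
  "const_polys = {Poly_Mapping.single 0 c | c. True}"

lemma const_polys_subfield: "subfield const_polys (poly_ring d)"
proof -
  interpret R: cring "poly_ring d" by (rule poly_ring_cring)
  have "subring const_polys (poly_ring d)"
  proof (rule R.subringI)
    fix p assume "p \<in> const_polys"
    then obtain c where p: "p = Poly_Mapping.single 0 c" by (auto simp: const_polys_def)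
    then have "a_inv (poly_ring d) p = Poly_Mapping.single 0 (- c)"
      by (simp add: uminus_poly_ring single_uminus)
    then show "a_inv (poly_ring d) p \<in> const_polys" by (auto simp: const_polys_def)
  next
    show "\<one>\<^bsub>poly_ring d\<^esub> \<in> const_polys" unfolding const_polys_def
      by (auto intro!: exI[of _ 1])
  qed (auto simp: const_polys_def mult_single single_add[symmetric])
  then have sub: "subcring const_polys (poly_ring d)" by (rule R.subcringI')
  have "Units (poly_ring d\<lparr>carrier := const_polys\<rparr>) = const_polys - {\<zero>\<^bsub>poly_ring d\<^esub>}"
  proof (intro equalityI subsetI)
    fix p assume "p \<in> const_polys - {\<zero>\<^bsub>poly_ring d\<^esub>}"
    then obtain c where c: "p = Poly_Mapping.single 0 c" "p \<noteq> 0" by (auto simp: const_polys_def)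
    then have "c \<noteq> 0" by auto
    moreover have "Poly_Mapping.single 0 (inverse c) \<in> const_polys" by (auto simp: const_polys_def)
    moreover have "Poly_Mapping.single 0 (inverse c) * p = 1" "p * Poly_Mapping.single 0 (inverse c) = 1"
      using \<open>c \<noteq> 0\<close> by (simp_all add: c(1) mult_single)
    ultimately show "p \<in> Units (poly_ring d\<lparr>carrier := const_polys\<rparr>)"
      using c(1) by (auto simp: Units_def const_polys_def)
  qed (auto simp: Units_def)
  then show ?thesis by (rule R.subfieldI[OF sub])
qed

lemma dimension_keys_subset:
  assumes "finite A" "A \<subseteq> mons d"
  shows "ring.dimension (poly_ring d) (card A) const_polys {p. Poly_Mapping.keys p \<subseteq> A}"
  using assms
proof (induction A rule: finite_induct)
  interpret R: ring "poly_ring d" by (rule poly_ring_ring)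
  case empty
  have "{p :: cpoly. Poly_Mapping.keys p \<subseteq> {}} = {\<zero>\<^bsub>poly_ring d\<^esub>}" by auto
  then show ?case using R.zero_dim[of const_polys] by simp
next
  interpret R: ring "poly_ring d" by (rule poly_ring_ring)
  case (insert a A)
  let ?E = "{p :: cpoly. Poly_Mapping.keys p \<subseteq> A}" and ?v = "Poly_Mapping.single a 1 :: cpoly"
  have "R.line_extension const_polys ?v ?E = {p. Poly_Mapping.keys p \<subseteq> insert a A}"
  proof (intro equalityI subsetI)
    fix p assume "p \<in> R.line_extension const_polys ?v ?E"
    then obtain c q where "p = Poly_Mapping.single 0 c * ?v + q" "Poly_Mapping.keys q \<subseteq> A"
      by (auto simp: R.line_extension_mem_iff const_polys_def)
    moreover have "Poly_Mapping.keys (Poly_Mapping.single 0 c * ?v) \<subseteq> insert a A"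
      using const_mult_keys[of c ?v] keys_single_subset[of a "1::complex"] by blast
    ultimately show "p \<in> {p. Poly_Mapping.keys p \<subseteq> insert a A}"
      using keys_plus_subset[of _ "insert a A" q] by auto
  next
    fix p :: cpoly assume p: "p \<in> {p. Poly_Mapping.keys p \<subseteq> insert a A}"
    let ?q = "p - Poly_Mapping.single a (Poly_Mapping.lookup p a)"
    have "Poly_Mapping.keys ?q \<subseteq> A"
      using p by (auto simp: in_keys_iff lookup_minus lookup_single when_def split: if_splits)
    moreover have "p = Poly_Mapping.single 0 (Poly_Mapping.lookup p a) * ?v + ?q"
      by (simp add: mult_single)
    ultimately show "p \<in> R.line_extension const_polys ?v ?E"
      unfolding R.line_extension_mem_iff const_polys_def poly_ring_ops by blast
  qed
  moreover have "?v \<in> carrier (poly_ring d)" "?v \<notin> ?E" using insert by auto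
  ultimately show ?case using R.Suc_dim[of ?v ?E "card A" const_polys] insert by auto
qed

text \<open>The quotient map is injective on the span of the standard monomials of degree
  \<open>n\<close>, and by reduction this span has the same image as all forms of degree
  \<open>n\<close>. The dimension is carried over along the map.\<close>

lemma hilbert_function_ig:
  assumes "d \<ge> 3"
  shows "hilbert_function d (ig_ideal d) n = card (std_deg d n)"
proof -
  let ?R = "poly_ring d" and ?I = "ig_ideal d"
  let ?Q = "?R Quot ?I" and ?h = "\<lambda>p. ?I +>\<^bsub>poly_ring d\<^esub> p"
  interpret I: ideal ?I ?R by (rule ig_ideal_ideal)
  interpret h: ring_hom_ring ?R ?Q ?h by (rule I.rcos_ring_hom_ring)
  let ?D = "{p. Poly_Mapping.keys p \<subseteq> std_deg d n}"
  let ?E = "{p \<in> carrier ?R. homogeneous n p}"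
  have D: "?D \<subseteq> ?E" using std_deg_mons[of d n] by (auto simp: homogeneous_def std_deg_def)
  have diff: "?h p = ?h q \<longleftrightarrow> p - q \<in> ?I" if "p \<in> carrier ?R" "q \<in> carrier ?R" for p q
  proof -
    have "p \<ominus>\<^bsub>?R\<^esub> q = p - q" using that by (simp add: a_minus_def uminus_poly_ring)
    then show ?thesis using I.quotient_eq_iff_same_a_r_cos[OF ig_ideal_ideal that] by simp
  qed
  have inj: "inj_on ?h ?D"
  proof (rule inj_onI)
    fix p q assume pq: "p \<in> ?D" "q \<in> ?D" "?h p = ?h q"
    then have "p \<in> carrier ?R" "q \<in> carrier ?R" using D by blast+
    then have "p - q \<in> ?I" using diff pq(3) by blast
    moreover have "Poly_Mapping.keys (p - q) \<subseteq> std_mons d"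
      using pq(1,2) unfolding std_deg_def by (intro keys_minus_subset) blast+
    ultimately have "p - q = 0" by (rule std_in_ideal_eq_0[OF assms])
    then show "p = q" by simp
  qed
  have img: "?h ` ?E = ?h ` ?D"
  proof (intro equalityI subsetI)
    fix y assume "y \<in> ?h ` ?E"
    then obtain p where p: "p \<in> carrier ?R" "homogeneous n p" "y = ?h p" by blast
    obtain g where g: "Poly_Mapping.keys g \<subseteq> std_deg d n" "p - g \<in> ?I"
      using std_reduction[OF assms p(1,2)] .
    then have "g \<in> carrier ?R" using D by blast
    then have "?h p = ?h g" using diff p(1) g(2) by blast
    then show "y \<in> ?h ` ?D" using g p(3) by auto
  qed (use D in blast)
  \<comment> \<open>The quotient must be nontrivial for the image of the constants to be a field.
    The constant 1 is not in the ideal because it does not vanish on the curve.\<close>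
  have one: "\<one>\<^bsub>?Q\<^esub> \<noteq> \<zero>\<^bsub>?Q\<^esub>"
  proof
    assume "\<one>\<^bsub>?Q\<^esub> = \<zero>\<^bsub>?Q\<^esub>"
    then have "?h 1 = ?h 0" using h.hom_one h.hom_zero by simp
    then have "1 \<in> ?I" using diff[of 1 0] by simp
    then have "1 \<in> cone_ideal d" using ig_ideal_subset_cone by blast
    then show False unfolding cone_ideal_def
      by simp (metis one_neq_zero)
  qed
  have "h.S.dimension (card (std_deg d n)) (?h ` const_polys) (?h ` ?D)"
    by (rule h.inj_hom_dimension[OF const_polys_subfield one inj
          dimension_keys_subset[OF finite_std_deg std_deg_mons]])
  moreover have "subfield (?h ` const_polys) ?Q"
    by (rule h.img_is_subfield(2)[OF const_polys_subfield one])
  ultimately have "h.S.dim (?h ` const_polys) (?h ` ?E) = card (std_deg d n)"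
    using h.S.dimI unfolding over_def img by blast
  then show ?thesis unfolding hilbert_function_def quot_image_def const_polys_def by simp
qed

section \<open>Generating functions of sets of monomials\<close>

definition deg_gf :: "mon set \<Rightarrow> rat fps" where
  "deg_gf A = Abs_fps (\<lambda>n. of_nat (card {a \<in> A. mon_deg a = n}))"

definition adjoin_var :: "nat \<Rightarrow> mon set \<Rightarrow> mon set" where
  "adjoin_var i B = {b + Poly_Mapping.single i k | b k. b \<in> B}"

text \<open>A monomial of degree \<open>n + 1\<close> either lacks the variable \<open>i\<close> and
  lies in \<open>B\<close>, or is that variable times a monomial of degree \<open>n\<close>. This
  recursion for the counts is multiplication by \<open>1 - fps_X\<close>.\<close>

lemma deg_gf_adjoin_var:
  assumes "B \<subseteq> mons d" "i \<le> d" "\<And>b. b \<in> B \<Longrightarrow> Poly_Mapping.lookup b i = 0"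
  shows "deg_gf (adjoin_var i B) * (1 - fps_X) = deg_gf B"
proof (rule fps_ext)
  let ?A = "adjoin_var i B"
  have "?A \<subseteq> mons d" using assms by (auto simp: adjoin_var_def)
  then have fin: "finite {a \<in> ?A. mon_deg a = n}" for n
    by (intro finite_subset[OF _ finite_mons_deg[of d n]]) auto
  have finB: "finite {a \<in> B. mon_deg a = n}" for n
    using assms(1) by (intro finite_subset[OF _ finite_mons_deg[of d n]]) auto
  have 0: "{a \<in> ?A. mon_deg a = 0} = {a \<in> B. mon_deg a = 0}"
  proof (intro equalityI subsetI)
    fix a assume "a \<in> {a \<in> ?A. mon_deg a = 0}"
    then obtain b k where "a = b + Poly_Mapping.single i k" "b \<in> B" "mon_deg a = 0"
      by (auto simp: adjoin_var_def)
    then show "a \<in> {a \<in> B. mon_deg a = 0}" by simp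
  next
    fix a assume "a \<in> {a \<in> B. mon_deg a = 0}"
    moreover from this have "a = a + Poly_Mapping.single i 0" by simp
    ultimately show "a \<in> {a \<in> ?A. mon_deg a = 0}"
      unfolding adjoin_var_def by blast
  qed
  have Suc: "{a \<in> ?A. mon_deg a = Suc n} = {a \<in> B. mon_deg a = Suc n} \<union>
      (\<lambda>a. a + var_mon i) ` {a \<in> ?A. mon_deg a = n}" (is "?l = ?r") for n
  proof (intro equalityI subsetI)
    fix a assume "a \<in> ?l"
    then obtain b k where a: "a = b + Poly_Mapping.single i k" "b \<in> B" "mon_deg a = Suc n"
      by (auto simp: adjoin_var_def)
    show "a \<in> ?r"
    proof (cases k)
      case 0
      then show ?thesis using a by simp
    next
      case (Suc k')
      then have eq: "a = (b + Poly_Mapping.single i k') + var_mon i"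
        using single_add[of i k' 1] by (simp add: a(1) add.assoc)
      moreover have "b + Poly_Mapping.single i k' \<in> {a \<in> ?A. mon_deg a = n}"
        using a(2,3) eq unfolding adjoin_var_def by auto
      ultimately show ?thesis by blast
    qed
  next
    fix a assume "a \<in> ?r"
    then consider "a \<in> B" "mon_deg a = Suc n"
      | b k where "b \<in> B" "a = (b + Poly_Mapping.single i k) + var_mon i"
          "mon_deg (b + Poly_Mapping.single i k) = n"
      unfolding adjoin_var_def by blast
    then show "a \<in> ?l"
    proof cases
      case 1
      moreover have "a = a + Poly_Mapping.single i 0" by simp
      ultimately show ?thesis unfolding adjoin_var_def by blast
    next
      case (2 b k)
      then have "a = b + Poly_Mapping.single i (k + 1)"
        using single_add[of i k 1] by (simp add: add.assoc)
      then show ?thesis using 2 unfolding adjoin_var_def by auto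
    qed
  qed
  have card: "card {a \<in> ?A. mon_deg a = Suc n} =
    card {a \<in> B. mon_deg a = Suc n} + card {a \<in> ?A. mon_deg a = n}" for n
  proof -
    have "{a \<in> B. mon_deg a = Suc n} \<inter> (\<lambda>a. a + var_mon i) ` {a \<in> ?A. mon_deg a = n} = {}"
    proof -
      have "Poly_Mapping.lookup (a + var_mon i) i \<noteq> 0" for a by (simp add: lookup_add)
      then have "a + var_mon i \<notin> B" for a using assms(3) by metis
      then show ?thesis by blast
    qed
    then show ?thesis unfolding Suc
      by (subst card_Un_disjoint) (auto simp: fin finB card_image inj_on_def)
  qed
  fix n
  show "fps_nth (deg_gf ?A * (1 - fps_X)) n = fps_nth (deg_gf B) n"
    by (cases n) (simp_all add: deg_gf_def right_diff_distrib 0 card)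
qed

lemma mon_deg_core: "m \<in> core_mons d \<Longrightarrow> mon_deg m \<le> 3"
  by (auto simp: core_mons_def)

text \<open>Antidiagonal terms see only the exponents of the variables \<open>1, ..., d - 2\<close>,
  so a term dividing \<open>a\<close> would divide \<open>m\<close>. Terms with \<open>i = 0\<close>
  have degree 4, which exceeds that of a core monomial. Any other term has degree 3 and would equal
  \<open>m\<close>, but it does not contain the variable 1, whereas cubic core monomials do.\<close>

lemma core_mons_std:
  assumes "m \<in> core_mons d"
    and t: "\<And>t. 1 \<le> t \<Longrightarrow> t \<le> d - 2 \<Longrightarrow> Poly_Mapping.lookup a t = Poly_Mapping.lookup m t"
    and "a \<in> mons d"
  shows "a \<in> std_mons d"
proof -
  have False if ijk: "i < j" "j < k" "k < d" and eq: "a = antidiag_mon i j k + e" for i j k e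
  proof -
    have keys: "Poly_Mapping.keys (antidiag_mon i j k) \<subseteq> {1..d-2}"
      using ijk by (auto simp: antidiag_mon_def keys_add_mon split: if_splits)
    have "Poly_Mapping.lookup (antidiag_mon i j k) t \<le> Poly_Mapping.lookup m t" for t
    proof (cases "t \<in> {1..d-2}")
      case True
      then have "Poly_Mapping.lookup m t = Poly_Mapping.lookup (antidiag_mon i j k) t + Poly_Mapping.lookup e t"
        using t[of t] by (simp add: eq lookup_add)
      then show ?thesis by simp
    next
      case False
      then show ?thesis using keys by (auto simp: in_keys_iff subset_eq)
    qed
    then have m: "m = antidiag_mon i j k + (m - antidiag_mon i j k)"
      by (intro poly_mapping_eqI) (simp add: lookup_add lookup_minus)
    then have deg: "mon_deg m = mon_deg (antidiag_mon i j k) + mon_deg (m - antidiag_mon i j k)"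
      by (metis mon_deg_add)
    moreover have "mon_deg (antidiag_mon 0 j k) = 4" by (simp add: antidiag_mon_def)
    ultimately have "i \<noteq> 0" using mon_deg_core[OF assms(1)] by (cases "i = 0") auto
    then have "mon_deg (antidiag_mon i j k) = 3" by (simp add: antidiag_mon_def)
    then have d3: "mon_deg m = 3" "m - antidiag_mon i j k = 0"
      using deg mon_deg_core[OF assms(1)] by (auto simp flip: mon_deg_eq_0_iff)
    then have "m = antidiag_mon i j k" using m by simp
    then have "Poly_Mapping.lookup m 1 = 0"
      using ijk \<open>i \<noteq> 0\<close> by (simp add: antidiag_mon_def lookup_add lookup_single when_def)
    moreover have "Poly_Mapping.lookup m 1 \<noteq> 0"
      using assms(1) d3(1) by (auto simp: core_mons_def lookup_add)
    ultimately show False by simp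
  qed
  then show ?thesis using assms(3) unfolding std_mons_def by blast
qed

lemma std_mons_adjoin:
  assumes "d \<ge> 3"
  shows "std_mons d = adjoin_var 0 (adjoin_var (d - 1) (adjoin_var d (core_mons d)))"
proof (intro equalityI subsetI)
  fix a assume "a \<in> std_mons d"
  then obtain n p q m where
    a: "a = Poly_Mapping.single 0 n + Poly_Mapping.single (d - 1) p + Poly_Mapping.single d q + m"
    "m \<in> core_mons d"
    using std_mons_decomp[OF assms] by blast
  have "m + Poly_Mapping.single d q \<in> adjoin_var d (core_mons d)"
    using a(2) unfolding adjoin_var_def by blast
  then have "m + Poly_Mapping.single d q + Poly_Mapping.single (d - 1) p
      \<in> adjoin_var (d - 1) (adjoin_var d (core_mons d))"
    unfolding adjoin_var_def[of "d - 1"] by blast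
  then have "m + Poly_Mapping.single d q + Poly_Mapping.single (d - 1) p + Poly_Mapping.single 0 n
      \<in> adjoin_var 0 (adjoin_var (d - 1) (adjoin_var d (core_mons d)))"
    unfolding adjoin_var_def[of 0] by blast
  then show "a \<in> adjoin_var 0 (adjoin_var (d - 1) (adjoin_var d (core_mons d)))"
    by (simp add: a(1) ac_simps)
next
  fix a assume "a \<in> adjoin_var 0 (adjoin_var (d - 1) (adjoin_var d (core_mons d)))"
  then obtain m n p q where a: "m \<in> core_mons d"
    "a = m + Poly_Mapping.single d q + Poly_Mapping.single (d - 1) p + Poly_Mapping.single 0 n"
    unfolding adjoin_var_def by blast
  show "a \<in> std_mons d"
  proof (rule core_mons_std[OF a(1)])
    have "m \<in> mons d" using core_mons_keys[OF a(1)] by (force simp: mons_def)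
    then show "a \<in> mons d" by (auto simp: a(2))
  qed (use assms in \<open>auto simp: a(2) lookup_add lookup_single when_def\<close>)
qed

lemma deg_gf_std:
  assumes "d \<ge> 3"
  shows "deg_gf (std_mons d) * (1 - fps_X) ^ 3 = deg_gf (core_mons d)"
proof -
  let ?B1 = "adjoin_var d (core_mons d)"
  let ?B2 = "adjoin_var (d - 1) ?B1"
  have core: "Poly_Mapping.lookup m i = 0" if "m \<in> core_mons d" "i \<notin> {1..d-2}" for m i
    using core_mons_keys[OF that(1)] that(2) by (auto simp: in_keys_iff subset_eq)
  have M0: "core_mons d \<subseteq> mons d" using core_mons_keys[of _ d] by (fastforce simp: mons_def)
  then have M1: "?B1 \<subseteq> mons d" by (auto simp: adjoin_var_def)
  then have M2: "?B2 \<subseteq> mons d" unfolding adjoin_var_def[of "d - 1"] by auto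
  have core': "Poly_Mapping.lookup m (d - Suc 0) = 0" if "m \<in> core_mons d" for m
    using assms by (intro core[OF that]) auto
  have "deg_gf (adjoin_var 0 ?B2) * (1 - fps_X) = deg_gf ?B2"
    using assms core by (intro deg_gf_adjoin_var[OF M2])
      (auto simp: adjoin_var_def lookup_add lookup_single when_def)
  moreover have "deg_gf ?B2 * (1 - fps_X) = deg_gf ?B1"
    using assms core' by (intro deg_gf_adjoin_var[OF M1])
      (auto simp: adjoin_var_def lookup_add lookup_single when_def)
  moreover have "deg_gf ?B1 * (1 - fps_X) = deg_gf (core_mons d)"
    using assms core by (intro deg_gf_adjoin_var[OF M0]) auto
  ultimately show ?thesis
    by (simp add: std_mons_adjoin[OF assms] power3_eq_cube mult.assoc[symmetric])
qed

lemma card_pairs: "card {(a, b). 1 \<le> a \<and> a \<le> b \<and> b \<le> (n :: nat)} = Suc n choose 2"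
proof -
  have "{(a, b). 1 \<le> a \<and> a \<le> b \<and> b \<le> n} = prod.swap ` (SIGMA b:{1..n}. {1..b})" by force
  then have "card {(a, b). 1 \<le> a \<and> a \<le> b \<and> b \<le> n} = card (SIGMA b:{1..n}. {1..b})"
    by (simp add: card_image)
  also have "\<dots> = (\<Sum>b\<in>{1..n}. b)" by simp
  also have "\<dots> = Suc n choose 2" by (induction n) (simp_all add: numeral_2_eq_2)
  finally show ?thesis .
qed

text \<open>The set of variables occurring already determines a sorted pair, because it is a
  singleton exactly when the two indices coincide.\<close>

lemma inj_pair_mon: "inj_on (\<lambda>(a, b). var_mon a + var_mon b) {(a, b). a \<le> b}"
proof (rule inj_onI, clarify)
  fix a b a' b' :: nat
  assume le: "a \<le> b" "a' \<le> b'" and eq: "var_mon a + var_mon b = var_mon a' + var_mon b'"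
  have "{a, b} = {a', b'}" using arg_cong[OF eq, of Poly_Mapping.keys] by (simp add: keys_add_mon insert_commute)
  then show "a = a' \<and> b = b'" using le by (auto simp: doubleton_eq_iff)
qed

text \<open>The cubic core monomials are the variable 1 times the quadratic ones, which is why the
  last two coefficients agree. The quadratic ones are all the quadratic monomials in
  \<open>d - 2\<close> variables.\<close>

lemma deg_gf_core:
  assumes "d \<ge> 3"
  shows "deg_gf (core_mons d) = 1 + of_nat (d - 2) * fps_X + of_nat ((d - 1) choose 2) * fps_X ^ 2
    + of_nat ((d - 1) choose 2) * fps_X ^ 3"
proof -
  let ?P = "{(a, b). 1 \<le> a \<and> a \<le> b \<and> b \<le> d - 2}"
  have P: "card ?P = (d - 1) choose 2" using card_pairs[of "d - 2"] assms by (simp add: Suc_diff_Suc numeral_2_eq_2)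
  have inj: "inj_on (\<lambda>(a, b). var_mon a + var_mon b) ?P"
    by (rule inj_on_subset[OF inj_pair_mon]) auto
  have "{m \<in> core_mons d. mon_deg m = 0} = {0}" by (auto simp: core_mons_def)
  then have 0: "card {m \<in> core_mons d. mon_deg m = 0} = 1" by simp
  have "{m \<in> core_mons d. mon_deg m = 1} = var_mon ` {1..d-2}" by (auto simp: core_mons_def)
  moreover have "inj_on var_mon {1..d-2}"
    by (rule inj_onI) (metis keys_single one_neq_zero singleton_inject)
  ultimately have 1: "card {m \<in> core_mons d. mon_deg m = 1} = d - 2" by (simp add: card_image)
  have "{m \<in> core_mons d. mon_deg m = 2} = (\<lambda>(a, b). var_mon a + var_mon b) ` ?P"
    by (auto simp: core_mons_def)
  then have 2: "card {m \<in> core_mons d. mon_deg m = 2} = (d - 1) choose 2"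
    using P inj by (simp add: card_image)
  have "{m \<in> core_mons d. mon_deg m = 3} = (\<lambda>m. var_mon 1 + m) ` (\<lambda>(a, b). var_mon a + var_mon b) ` ?P"
    by (force simp: core_mons_def add.assoc image_iff)
  then have 3: "card {m \<in> core_mons d. mon_deg m = 3} = (d - 1) choose 2"
    using P inj by (simp add: card_image inj_on_def[of "\<lambda>m. var_mon 1 + m"])
  have 4: "card {m \<in> core_mons d. mon_deg m = n} = 0" if "n > 3" for n
  proof -
    have "{m \<in> core_mons d. mon_deg m = n} = {}" using mon_deg_core that by force
    then show ?thesis by (simp only: card.empty)
  qed
  show ?thesis
  proof (rule fps_ext)
    fix n :: nat
    consider "n = 0" | "n = 1" | "n = 2" | "n = 3" | "n > 3" by linarith
    then show "fps_nth (deg_gf (core_mons d)) n = fps_nth (1 + of_nat (d - 2) * fps_X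
        + of_nat ((d - 1) choose 2) * fps_X ^ 2 + of_nat ((d - 1) choose 2) * fps_X ^ 3) n"
      by cases (simp_all add: deg_gf_def 0 1[simplified] 2 3 4 fps_X_power_nth flip: fps_of_nat)
  qed
qed

theorem proposition3p4:
  fixes d :: nat
  assumes "d \<ge> 3"
  shows "antidiagonal_order d revlex \<and>
    (\<forall>leq. antidiagonal_order d leq \<longrightarrow>
       groebner_basis d leq (ig_minors d) (vanishing_ideal d (ig_variety d))) \<and>
    hilbert_series d (vanishing_ideal d (ig_variety d)) =
      (1 + of_nat (d - 2) * fps_X + of_nat ((d - 1) choose 2) * fps_X ^ 2
         + of_nat ((d - 1) choose 2) * fps_X ^ 3) / (1 - fps_X) ^ 3"
proof (intro conjI allI impI)
  show "antidiagonal_order d revlex" by (rule revlex_antidiagonal_order)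
  show "groebner_basis d leq (ig_minors d) (vanishing_ideal d (ig_variety d))"
    if "antidiagonal_order d leq" for leq
    using ig_groebner[OF assms that] by (simp add: vanishing_ideal_ig_variety)
  have hs: "hilbert_series d (vanishing_ideal d (ig_variety d)) = deg_gf (std_mons d)"
    by (simp add: hilbert_series_def vanishing_ideal_ig_variety hilbert_function_ig[OF assms]
        deg_gf_def std_deg_def)
  have "(1 - fps_X :: rat fps) \<noteq> 0"
    by (auto simp: fps_eq_iff intro!: exI[of _ 0])
  then have "deg_gf (std_mons d) = deg_gf (std_mons d) * (1 - fps_X) ^ 3 / (1 - fps_X) ^ 3"
    by (intro nonzero_mult_div_cancel_right[symmetric]) simp
  then show "hilbert_series d (vanishing_ideal d (ig_variety d)) =
      (1 + of_nat (d - 2) * fps_X + of_nat ((d - 1) choose 2) * fps_X ^ 2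
         + of_nat ((d - 1) choose 2) * fps_X ^ 3) / (1 - fps_X) ^ 3"
    by (simp only: hs deg_gf_std[OF assms] deg_gf_core[OF assms])
qed

end
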